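(* Let $\mathbb V:V_1\xrightarrow{\mathrm d}V_0$ be a 2-term complex of finite-dimensional real vector spaces, and let $\mathrm{End}(\mathbb V)=(\mathfrak k_1,\mathfrak k_0,\delta,\phi)$ be its crossed module of Lie algebras. The set $$K_1=\Big\{M\in\mathrm{Hom}(V_0,V_1):\ \begin{pmatrix}I+\mathrm d\circ M&0\\0&M\circ\mathrm d+I\end{pmatrix}\in GL(V_0\oplus V_1)\Big\}$$ is a Lie group with multiplication $M_1\cdot M_2=M_1+M_2+M_1\circ\mathrm d\circ M_2$, identity $0$, and inverse $$M^{-1}=-(I+M\circ\mathrm d)^{-1}\circ M=-M\circ(I+\mathrm d\circ M)^{-1},$$ and its Lie algebra is $\mathfrak k_1$. Let $$K_0=\Big\{\begin{pmatrix}B_0&0\\0&B_1\end{pmatrix}:\ B_0\in GL(V_0),\ B_1\in GL(V_1),\ B_0\circ\mathrm d=\mathrm d\circ B_1\Big\},$$ a Lie group with Lie algebra $\mathfrak k_0$. The map $\int\delta:K_1\to K_0$, $$\Big(\int\delta\Big)(M)=\begin{pmatrix}I+\mathrm d\circ M&0\\0&M\circ\mathrm d+I\end{pmatrix},$$ is a Lie group morphism that differentiates to the Lie algebra morphism $\delta:\mathfrak k_1\to\mathfrak k_0$. The action $\Phi$ of $K_0$ on $K_1$ given by $$\Phi_{\begin{pmatrix}B_0&0\\0&B_1\end{pmatrix}}M=B_1\circ M\circ B_0^{-1}$$ differentiates to the action $\phi$ of $\mathfrak k_0$ on $\mathfrak k_1$. Furthermore, $\mathrm{Aut}(\mathbb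 V):=(K_1,K_0,\int\delta,\Phi)$ is a crossed module of Lie groups whose differentiation is the crossed module of Lie algebras $\mathrm{End}(\mathbb V)$.
   Context: A crossed module of Lie groups $(H_1,H_0,t,\Phi)$ consists of Lie groups $H_1,H_0$, a Lie group morphism $t:H_1\to H_0$ and a smooth action $\Phi$ of $H_0$ on $H_1$ by group automorphisms with $t(\Phi_g(h))=g\,t(h)\,g^{-1}$ and $\Phi_{t(h)}(h')=hh'h^{-1}$. A crossed module of Lie algebras $(\mathfrak h_1,\mathfrak h_0,dt,\phi)$ consists of Lie algebras, a Lie algebra morphism $dt:\mathfrak h_1\to\mathfrak h_0$ and an action $\phi:\mathfrak h_0\to\mathrm{Der}(\mathfrak h_1)$ with $dt(\phi_X(A))=[X,dt(A)]$ and $\phi_{dt(A)}(B)=[A,B]$. Differentiating the groups and maps of a crossed module of Lie groups yields a crossed module of Lie algebras. $\mathrm{End}(\mathbb V)=(\mathfrak k_1,\mathfrak k_0,\delta,\phi)$ is defined by: $\mathfrak k_1=\mathrm{Hom}(V_0,V_1)$ with bracket $[A,B]_{\mathfrak k_1}=A\circ\mathrm d\circ B-B\circ\mathrm d\circ A$; $\mathfrak k_0=\{(X_0,X_1)\in\mathrm{End}(V_0)\oplus\mathrm{End}(V_1):X_0\circ\mathrm d=\mathrm d\circ X_1\}$ with the commutator bracket; $\delta(A)=(\mathrm d\circ A,\ A\circ\mathrm d)$; $\phi_{(X_0,X_1)}(A)=X_1\circ A-A\circ X_0$. *)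

theory Defs
  imports "HOL-Analysis.Analysis" "HOL-Algebra.Group"
begin

section \<open>Smooth maps on open subsets of a finite-dimensional vector space\<close>

definition finite_dim :: "'m::real_vector set \<Rightarrow> bool" where
  "finite_dim E \<longleftrightarrow> (\<exists>B. finite B \<and> span B = E)"

text \<open>The derivative at \<open>t = 0\<close> of \<open>f (x + t v)\<close>. It only depends on the values of \<open>f\<close> near
  \<open>x\<close> on the line spanned by \<open>v\<close>. If \<open>S\<close> is a relatively open subset of a linear subspace
  \<open>E\<close>, \<open>x \<in> S\<close> and \<open>v \<in> E\<close>, it therefore does not see the values of \<open>f\<close> outside \<open>S\<close>.\<close>

definition dirderiv ::
  "('m::real_normed_vector \<Rightarrow> 'n::real_normed_vector) \<Rightarrow> 'm \<Rightarrow> 'm \<Rightarrow> 'n" where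
  "dirderiv f x v = vector_derivative (\<lambda>t. f (x + t *\<^sub>R v)) (at 0)"

text \<open>\<open>Ck_on k E S f\<close>: the map \<open>f\<close> is of class \<open>C\<^sup>k\<close> on the relatively open subset \<open>S\<close> of the
  finite-dimensional linear subspace \<open>E\<close>.\<close>

primrec Ck_on ::
  "nat \<Rightarrow> 'm::real_normed_vector set \<Rightarrow> 'm set \<Rightarrow> ('m \<Rightarrow> 'n::real_normed_vector) \<Rightarrow> bool" where
  "Ck_on 0 E S f \<longleftrightarrow> continuous_on S f"
| "Ck_on (Suc k) E S f \<longleftrightarrow>
     f differentiable_on S \<and> (\<forall>v\<in>E. Ck_on k E S (\<lambda>x. dirderiv f x v))"

definition smooth_on ::
  "'m::real_normed_vector set \<Rightarrow> 'm set \<Rightarrow> ('m \<Rightarrow> 'n::real_normed_vector) \<Rightarrow> bool" where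
  "smooth_on E S f \<longleftrightarrow> (\<forall>k. Ck_on k E S f)"


section \<open>Smooth manifolds\<close>

text \<open>A chart is a pair \<open>(U, \<phi>)\<close>. The charts of a manifold take values in a fixed
  finite-dimensional linear subspace (the model space) of a normed space; using a subspace rather
  than a whole type allows every dimension, including \<open>0\<close>.\<close>

type_synonym ('p, 'm) chart = "'p set \<times> ('p \<Rightarrow> 'm)"

record ('p, 'm) manifold =
  mtop :: "'p topology"
  model :: "'m set"
  atlas :: "('p, 'm) chart set"

definition smooth_chart ::
  "'p topology \<Rightarrow> 'm::real_normed_vector set \<Rightarrow> ('p, 'm) chart \<Rightarrow> bool" where
  "smooth_chart X E = (\<lambda>(U, \<phi>).
     openin X U \<and> openin (top_of_set E) (\<phi> ` U) \<and>
     homeomorphic_map (subtopology X U) (top_of_set (\<phi> ` U)) \<phi>)"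

definition smooth_manifold :: "('p, 'm::real_normed_vector) manifold \<Rightarrow> bool" where
  "smooth_manifold M \<longleftrightarrow>
     Hausdorff_space (mtop M) \<and> second_countable (mtop M) \<and> finite_dim (model M) \<and>
     (\<forall>c\<in>atlas M. smooth_chart (mtop M) (model M) c) \<and>
     (\<Union>c\<in>atlas M. fst c) = topspace (mtop M) \<and>
     (\<forall>(U, \<phi>)\<in>atlas M. \<forall>(V, \<psi>)\<in>atlas M.
        smooth_on (model M) (\<phi> ` (U \<inter> V)) (\<psi> \<circ> inv_into U \<phi>))"

definition smooth_map ::
  "('p, 'm::real_normed_vector) manifold \<Rightarrow> ('q, 'n::real_normed_vector) manifold
     \<Rightarrow> ('p \<Rightarrow> 'q) \<Rightarrow> bool" where
  "smooth_map M N f \<longleftrightarrow>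
     continuous_map (mtop M) (mtop N) f \<and>
     (\<forall>(U, \<phi>)\<in>atlas M. \<forall>(V, \<psi>)\<in>atlas N.
        smooth_on (model M) (\<phi> ` (U \<inter> f -` V)) (\<psi> \<circ> f \<circ> inv_into U \<phi>))"

definition prod_manifold ::
  "('p, 'm) manifold \<Rightarrow> ('q, 'n) manifold \<Rightarrow> ('p \<times> 'q, 'm \<times> 'n) manifold" where
  "prod_manifold M N =
     \<lparr>mtop = prod_topology (mtop M) (mtop N),
      model = model M \<times> model N,
      atlas = {(U \<times> V, map_prod \<phi> \<psi>) |U \<phi> V \<psi>. (U, \<phi>) \<in> atlas M \<and> (V, \<psi>) \<in> atlas N}\<rparr>"

text \<open>A tangent vector at \<open>p\<close> is a family of vectors of the model space, one for each chart around
  \<open>p\<close>, transforming by the derivatives of the transition maps. It is extended by \<open>0\<close> to all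
  other charts, so that tangent vectors can be added and scaled pointwise.\<close>

definition tangent_space ::
  "('p, 'm::real_normed_vector) manifold \<Rightarrow> 'p \<Rightarrow> (('p, 'm) chart \<Rightarrow> 'm) set" where
  "tangent_space M p = {v.
     (\<forall>U \<phi>. (U, \<phi>) \<in> atlas M \<and> p \<in> U \<longrightarrow> v (U, \<phi>) \<in> model M) \<and>
     (\<forall>U \<phi>. \<not> ((U, \<phi>) \<in> atlas M \<and> p \<in> U) \<longrightarrow> v (U, \<phi>) = 0) \<and>
     (\<forall>U \<phi> V \<psi>. (U, \<phi>) \<in> atlas M \<and> p \<in> U \<and> (V, \<psi>) \<in> atlas M \<and> p \<in> V \<longrightarrow>
        v (V, \<psi>) = dirderiv (\<psi> \<circ> inv_into U \<phi>) (\<phi> p) (v (U, \<phi>)))}"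

definition chart_at :: "('p, 'm) manifold \<Rightarrow> 'p \<Rightarrow> ('p, 'm) chart" where
  "chart_at M p = (SOME c. c \<in> atlas M \<and> p \<in> fst c)"

text \<open>The differential of \<open>f\<close> at \<open>p\<close>. By the transformation rule the choice made by
  \<open>chart_at\<close> is irrelevant on tangent vectors.\<close>

definition tangent_map ::
  "('p, 'm::real_normed_vector) manifold \<Rightarrow> ('q, 'n::real_normed_vector) manifold \<Rightarrow> ('p \<Rightarrow> 'q)
     \<Rightarrow> 'p \<Rightarrow> (('p, 'm) chart \<Rightarrow> 'm) \<Rightarrow> (('q, 'n) chart \<Rightarrow> 'n)" where
  "tangent_map M N f p v = (\<lambda>(V, \<psi>).
     if (V, \<psi>) \<in> atlas N \<and> f p \<in> V
     then (let (U, \<phi>) = chart_at M p in dirderiv (\<psi> \<circ> f \<circ> inv_into U \<phi>) (\<phi> p) (v (U, \<phi>)))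
     else 0)"

text \<open>The bracket \<open>[X, Y] = X Y - Y X\<close> of vector fields; in a chart it is
  \<open>D Y (X) - D X (Y)\<close>.\<close>

definition vector_field_bracket ::
  "('p, 'm::real_normed_vector) manifold \<Rightarrow> ('p \<Rightarrow> ('p, 'm) chart \<Rightarrow> 'm)
     \<Rightarrow> ('p \<Rightarrow> ('p, 'm) chart \<Rightarrow> 'm) \<Rightarrow> 'p \<Rightarrow> ('p, 'm) chart \<Rightarrow> 'm" where
  "vector_field_bracket M X Y p = (\<lambda>(U, \<phi>).
     if (U, \<phi>) \<in> atlas M \<and> p \<in> U
     then dirderiv (\<lambda>x. Y (inv_into U \<phi> x) (U, \<phi>)) (\<phi> p) (X p (U, \<phi>))
        - dirderiv (\<lambda>x. X (inv_into U \<phi> x) (U, \<phi>)) (\<phi> p) (Y p (U, \<phi>))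
     else 0)"


section \<open>Lie algebras\<close>

record 'v lie_alg =
  lcarrier :: "'v set"
  lzero :: 'v
  ladd :: "'v \<Rightarrow> 'v \<Rightarrow> 'v"
  lscale :: "real \<Rightarrow> 'v \<Rightarrow> 'v"
  lbracket :: "'v \<Rightarrow> 'v \<Rightarrow> 'v"

definition lie_algebra :: "'v lie_alg \<Rightarrow> bool" where
  "lie_algebra L \<longleftrightarrow>
     comm_group \<lparr>carrier = lcarrier L, monoid.mult = ladd L, one = lzero L\<rparr> \<and>
     (\<forall>r. \<forall>x\<in>lcarrier L. lscale L r x \<in> lcarrier L) \<and>
     (\<forall>x\<in>lcarrier L. lscale L 1 x = x) \<and>
     (\<forall>r s. \<forall>x\<in>lcarrier L. lscale L (r * s) x = lscale L r (lscale L s x)) \<and>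
     (\<forall>r s. \<forall>x\<in>lcarrier L. lscale L (r + s) x = ladd L (lscale L r x) (lscale L s x)) \<and>
     (\<forall>r. \<forall>x\<in>lcarrier L. \<forall>y\<in>lcarrier L.
        lscale L r (ladd L x y) = ladd L (lscale L r x) (lscale L r y)) \<and>
     (\<forall>x\<in>lcarrier L. \<forall>y\<in>lcarrier L. lbracket L x y \<in> lcarrier L) \<and>
     (\<forall>x\<in>lcarrier L. \<forall>y\<in>lcarrier L. \<forall>z\<in>lcarrier L.
        lbracket L (ladd L x y) z = ladd L (lbracket L x z) (lbracket L y z) \<and>
        lbracket L z (ladd L x y) = ladd L (lbracket L z x) (lbracket L z y)) \<and>
     (\<forall>r. \<forall>x\<in>lcarrier L. \<forall>y\<in>lcarrier L.
        lbracket L (lscale L r x) y = lscale L r (lbracket L x y) \<and>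
        lbracket L x (lscale L r y) = lscale L r (lbracket L x y)) \<and>
     (\<forall>x\<in>lcarrier L. lbracket L x x = lzero L) \<and>
     (\<forall>x\<in>lcarrier L. \<forall>y\<in>lcarrier L. \<forall>z\<in>lcarrier L.
        ladd L (lbracket L x (lbracket L y z))
          (ladd L (lbracket L y (lbracket L z x)) (lbracket L z (lbracket L x y))) = lzero L)"

definition lie_linear :: "'v lie_alg \<Rightarrow> 'w lie_alg \<Rightarrow> ('v \<Rightarrow> 'w) \<Rightarrow> bool" where
  "lie_linear L L' f \<longleftrightarrow>
     (\<forall>x\<in>lcarrier L. f x \<in> lcarrier L') \<and>
     (\<forall>x\<in>lcarrier L. \<forall>y\<in>lcarrier L. f (ladd L x y) = ladd L' (f x) (f y)) \<and>
     (\<forall>r. \<forall>x\<in>lcarrier L. f (lscale L r x) = lscale L' r (f x))"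

definition lie_algebra_hom :: "'v lie_alg \<Rightarrow> 'w lie_alg \<Rightarrow> ('v \<Rightarrow> 'w) \<Rightarrow> bool" where
  "lie_algebra_hom L L' f \<longleftrightarrow>
     lie_linear L L' f \<and>
     (\<forall>x\<in>lcarrier L. \<forall>y\<in>lcarrier L. f (lbracket L x y) = lbracket L' (f x) (f y))"

definition lie_algebra_iso :: "'v lie_alg \<Rightarrow> 'w lie_alg \<Rightarrow> ('v \<Rightarrow> 'w) \<Rightarrow> bool" where
  "lie_algebra_iso L L' f \<longleftrightarrow>
     lie_algebra_hom L L' f \<and> bij_betw f (lcarrier L) (lcarrier L')"

definition derivation :: "'v lie_alg \<Rightarrow> ('v \<Rightarrow> 'v) \<Rightarrow> bool" where
  "derivation L D \<longleftrightarrow>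
     lie_linear L L D \<and>
     (\<forall>x\<in>lcarrier L. \<forall>y\<in>lcarrier L.
        D (lbracket L x y) = ladd L (lbracket L (D x) y) (lbracket L x (D y)))"

text \<open>\<open>\<phi>\<close> is a Lie algebra morphism from \<open>L\<^sub>0\<close> to \<open>Der(L\<^sub>1)\<close>. The commutator identity is written
  without subtraction.\<close>

definition lie_algebra_action ::
  "'w lie_alg \<Rightarrow> 'v lie_alg \<Rightarrow> ('w \<Rightarrow> 'v \<Rightarrow> 'v) \<Rightarrow> bool" where
  "lie_algebra_action L0 L1 \<phi> \<longleftrightarrow>
     (\<forall>X\<in>lcarrier L0. derivation L1 (\<phi> X)) \<and>
     (\<forall>X\<in>lcarrier L0. \<forall>Y\<in>lcarrier L0. \<forall>A\<in>lcarrier L1.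
        \<phi> (ladd L0 X Y) A = ladd L1 (\<phi> X A) (\<phi> Y A)) \<and>
     (\<forall>r. \<forall>X\<in>lcarrier L0. \<forall>A\<in>lcarrier L1. \<phi> (lscale L0 r X) A = lscale L1 r (\<phi> X A)) \<and>
     (\<forall>X\<in>lcarrier L0. \<forall>Y\<in>lcarrier L0. \<forall>A\<in>lcarrier L1.
        ladd L1 (\<phi> (lbracket L0 X Y) A) (\<phi> Y (\<phi> X A)) = \<phi> X (\<phi> Y A))"

type_synonym ('v, 'w) lie_alg_xmod =
  "'v lie_alg \<times> 'w lie_alg \<times> ('v \<Rightarrow> 'w) \<times> ('w \<Rightarrow> 'v \<Rightarrow> 'v)"

definition crossed_module_lie_algebra :: "('v, 'w) lie_alg_xmod \<Rightarrow> bool" where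
  "crossed_module_lie_algebra = (\<lambda>(L1, L0, dt, \<phi>).
     lie_algebra L1 \<and> lie_algebra L0 \<and>
     lie_algebra_hom L1 L0 dt \<and> lie_algebra_action L0 L1 \<phi> \<and>
     (\<forall>X\<in>lcarrier L0. \<forall>A\<in>lcarrier L1. dt (\<phi> X A) = lbracket L0 X (dt A)) \<and>
     (\<forall>A\<in>lcarrier L1. \<forall>B\<in>lcarrier L1. \<phi> (dt A) B = lbracket L1 A B))"

definition crossed_module_lie_algebra_iso ::
  "('v, 'w) lie_alg_xmod \<Rightarrow> ('v', 'w') lie_alg_xmod \<Rightarrow> ('v \<Rightarrow> 'v') \<Rightarrow> ('w \<Rightarrow> 'w') \<Rightarrow> bool" where
  "crossed_module_lie_algebra_iso = (\<lambda>(L1, L0, dt, \<phi>) (L1', L0', dt', \<phi>') f1 f0.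
     lie_algebra_iso L1 L1' f1 \<and> lie_algebra_iso L0 L0' f0 \<and>
     (\<forall>A\<in>lcarrier L1. f0 (dt A) = dt' (f1 A)) \<and>
     (\<forall>X\<in>lcarrier L0. \<forall>A\<in>lcarrier L1. f1 (\<phi> X A) = \<phi>' (f0 X) (f1 A)))"


section \<open>Lie groups\<close>

record ('p, 'm) lie_grp = "'p monoid" +
  mfd :: "('p, 'm) manifold"

definition lie_group :: "('p, 'm::real_normed_vector) lie_grp \<Rightarrow> bool" where
  "lie_group G \<longleftrightarrow>
     group G \<and> smooth_manifold (mfd G) \<and> topspace (mtop (mfd G)) = carrier G \<and>
     smooth_map (prod_manifold (mfd G) (mfd G)) (mfd G) (\<lambda>(x, y). x \<otimes>\<^bsub>G\<^esub> y) \<and>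
     smooth_map (mfd G) (mfd G) (\<lambda>x. inv\<^bsub>G\<^esub> x)"

definition lie_group_hom ::
  "('p, 'm::real_normed_vector) lie_grp \<Rightarrow> ('q, 'n::real_normed_vector) lie_grp
     \<Rightarrow> ('p \<Rightarrow> 'q) \<Rightarrow> bool" where
  "lie_group_hom G H t \<longleftrightarrow> t \<in> hom G H \<and> smooth_map (mfd G) (mfd H) t"

definition lie_group_action ::
  "('q, 'n::real_normed_vector) lie_grp \<Rightarrow> ('p, 'm::real_normed_vector) lie_grp
     \<Rightarrow> ('q \<Rightarrow> 'p \<Rightarrow> 'p) \<Rightarrow> bool" where
  "lie_group_action G H \<Phi> \<longleftrightarrow>
     smooth_map (prod_manifold (mfd G) (mfd H)) (mfd H) (\<lambda>(g, h). \<Phi> g h) \<and>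
     (\<forall>g\<in>carrier G. \<Phi> g \<in> iso H H) \<and>
     (\<forall>h\<in>carrier H. \<Phi> \<one>\<^bsub>G\<^esub> h = h) \<and>
     (\<forall>g\<in>carrier G. \<forall>g'\<in>carrier G. \<forall>h\<in>carrier H. \<Phi> (g \<otimes>\<^bsub>G\<^esub> g') h = \<Phi> g (\<Phi> g' h))"

type_synonym ('p, 'm, 'q, 'n) lie_grp_xmod =
  "('p, 'm) lie_grp \<times> ('q, 'n) lie_grp \<times> ('p \<Rightarrow> 'q) \<times> ('q \<Rightarrow> 'p \<Rightarrow> 'p)"

definition crossed_module_lie_group ::
  "('p, 'm::real_normed_vector, 'q, 'n::real_normed_vector) lie_grp_xmod \<Rightarrow> bool" where
  "crossed_module_lie_group = (\<lambda>(H1, H0, t, \<Phi>).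
     lie_group H1 \<and> lie_group H0 \<and>
     lie_group_hom H1 H0 t \<and> lie_group_action H0 H1 \<Phi> \<and>
     (\<forall>g\<in>carrier H0. \<forall>h\<in>carrier H1. t (\<Phi> g h) = g \<otimes>\<^bsub>H0\<^esub> t h \<otimes>\<^bsub>H0\<^esub> inv\<^bsub>H0\<^esub> g) \<and>
     (\<forall>h\<in>carrier H1. \<forall>h'\<in>carrier H1. \<Phi> (t h) h' = h \<otimes>\<^bsub>H1\<^esub> h' \<otimes>\<^bsub>H1\<^esub> inv\<^bsub>H1\<^esub> h))"


section \<open>Differentiation\<close>

definition left_invariant_field ::
  "('p, 'm::real_normed_vector) lie_grp \<Rightarrow> (('p, 'm) chart \<Rightarrow> 'm)
     \<Rightarrow> 'p \<Rightarrow> (('p, 'm) chart \<Rightarrow> 'm)" where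
  "left_invariant_field G v g = tangent_map (mfd G) (mfd G) (\<lambda>h. g \<otimes>\<^bsub>G\<^esub> h) \<one>\<^bsub>G\<^esub> v"

text \<open>The Lie algebra of \<open>G\<close>: the tangent space at the identity, with the bracket of left-invariant
  vector fields.\<close>

definition lie_algebra_of ::
  "('p, 'm::real_normed_vector) lie_grp \<Rightarrow> (('p, 'm) chart \<Rightarrow> 'm) lie_alg" where
  "lie_algebra_of G =
     \<lparr>lcarrier = tangent_space (mfd G) \<one>\<^bsub>G\<^esub>,
      lzero = (\<lambda>c. 0),
      ladd = (\<lambda>v w c. v c + w c),
      lscale = (\<lambda>r v c. r *\<^sub>R v c),
      lbracket = (\<lambda>v w. vector_field_bracket (mfd G)
        (left_invariant_field G v) (left_invariant_field G w) \<one>\<^bsub>G\<^esub>)\<rparr>"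

definition diff_hom ::
  "('p, 'm::real_normed_vector) lie_grp \<Rightarrow> ('q, 'n::real_normed_vector) lie_grp \<Rightarrow> ('p \<Rightarrow> 'q)
     \<Rightarrow> (('p, 'm) chart \<Rightarrow> 'm) \<Rightarrow> (('q, 'n) chart \<Rightarrow> 'n)" where
  "diff_hom G H t = tangent_map (mfd G) (mfd H) t \<one>\<^bsub>G\<^esub>"

text \<open>The differentiated action: \<open>\<phi>\<^sub>X(A)\<close> is the derivative at \<open>g = 1\<close> in direction \<open>X\<close> of
  \<open>g \<mapsto> d(\<Phi>\<^sub>g)\<^sub>1(A)\<close>, a map from \<open>G\<close> to the vector space \<open>T\<^sub>1H\<close> (recall \<open>\<Phi>\<^sub>g(1) = 1\<close>).
  The derivative is taken in each component of \<open>T\<^sub>1H\<close>.\<close>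

definition diff_action ::
  "('q, 'n::real_normed_vector) lie_grp \<Rightarrow> ('p, 'm::real_normed_vector) lie_grp
     \<Rightarrow> ('q \<Rightarrow> 'p \<Rightarrow> 'p)
     \<Rightarrow> (('q, 'n) chart \<Rightarrow> 'n) \<Rightarrow> (('p, 'm) chart \<Rightarrow> 'm) \<Rightarrow> (('p, 'm) chart \<Rightarrow> 'm)" where
  "diff_action G H \<Phi> X A c =
     (let (U, \<phi>) = chart_at (mfd G) \<one>\<^bsub>G\<^esub> in
      dirderiv (\<lambda>x. diff_hom H H (\<Phi> (inv_into U \<phi> x)) A c) (\<phi> \<one>\<^bsub>G\<^esub>) (X (U, \<phi>)))"

definition differentiate ::
  "('p, 'm::real_normed_vector, 'q, 'n::real_normed_vector) lie_grp_xmod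
     \<Rightarrow> (('p, 'm) chart \<Rightarrow> 'm, ('q, 'n) chart \<Rightarrow> 'n) lie_alg_xmod" where
  "differentiate = (\<lambda>(H1, H0, t, \<Phi>).
     (lie_algebra_of H1, lie_algebra_of H0, diff_hom H1 H0 t, diff_action H0 H1 \<Phi>))"


section \<open>Open subsets of a linear space\<close>

text \<open>The standard smooth structure on a relatively open subset \<open>S\<close> of a finite-dimensional linear
  subspace \<open>E\<close>, and the canonical identification of its tangent spaces with \<open>E\<close>.\<close>

definition open_submanifold :: "'m::real_normed_vector set \<Rightarrow> 'm set \<Rightarrow> ('m, 'm) manifold" where
  "open_submanifold E S = \<lparr>mtop = top_of_set S, model = E, atlas = {(S, \<lambda>x. x)}\<rparr>"

definition tangent_coord :: "'m set \<Rightarrow> (('m, 'm) chart \<Rightarrow> 'm) \<Rightarrow> 'm" where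
  "tangent_coord S v = v (S, \<lambda>x. x)"


section \<open>The crossed modules of a 2-term complex\<close>

text \<open>Throughout, \<open>d : V\<^sub>1 \<rightarrow> V\<^sub>0\<close> has type \<open>'b \<Rightarrow>\<^sub>L 'a\<close>, with \<open>V\<^sub>0 = 'a\<close> and \<open>V\<^sub>1 = 'b\<close>. The type
  class of normed spaces is used instead of Euclidean spaces because the latter are never
  zero-dimensional. In finite dimension every linear map is bounded, so \<open>\<Rightarrow>\<^sub>L\<close> is the full space
  of linear maps, and the topology and smooth structure do not depend on the norm.\<close>

definition GL :: "('v::real_normed_vector \<Rightarrow>\<^sub>L 'v) set" where
  "GL = {T. \<exists>S. S o\<^sub>L T = id_blinfun \<and> T o\<^sub>L S = id_blinfun}"

definition GL_inv :: "('v::real_normed_vector \<Rightarrow>\<^sub>L 'v) \<Rightarrow> ('v \<Rightarrow>\<^sub>L 'v)" where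
  "GL_inv T = (THE S. S o\<^sub>L T = id_blinfun \<and> T o\<^sub>L S = id_blinfun)"

lift_definition block_diag ::
  "('a::real_normed_vector \<Rightarrow>\<^sub>L 'a) \<times> ('b::real_normed_vector \<Rightarrow>\<^sub>L 'b) \<Rightarrow> ('a \<times> 'b) \<Rightarrow>\<^sub>L ('a \<times> 'b)"
  is "\<lambda>(B0, B1) (x, y). (B0 x, B1 y)"
proof (clarsimp simp: case_prod_beta')
  fix B0 :: "'a \<Rightarrow> 'a" and B1 :: "'b \<Rightarrow> 'b"
  assume "bounded_linear B0" "bounded_linear B1"
  then show "bounded_linear (\<lambda>p. (B0 (fst p), B1 (snd p)))"
    by (intro bounded_linear_Pair bounded_linear_compose[OF _ bounded_linear_fst]
        bounded_linear_compose[OF _ bounded_linear_snd])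
qed

definition k1 :: "('b::real_normed_vector \<Rightarrow>\<^sub>L 'a::real_normed_vector) \<Rightarrow> ('a \<Rightarrow>\<^sub>L 'b) lie_alg" where
  "k1 d = \<lparr>lcarrier = UNIV, lzero = 0, ladd = (+), lscale = (*\<^sub>R),
     lbracket = (\<lambda>A B. (A o\<^sub>L d o\<^sub>L B) - (B o\<^sub>L d o\<^sub>L A))\<rparr>"

definition k0 ::
  "('b::real_normed_vector \<Rightarrow>\<^sub>L 'a::real_normed_vector) \<Rightarrow> (('a \<Rightarrow>\<^sub>L 'a) \<times> ('b \<Rightarrow>\<^sub>L 'b)) lie_alg" where
  "k0 d = \<lparr>lcarrier = {(X0, X1). X0 o\<^sub>L d = d o\<^sub>L X1}, lzero = 0, ladd = (+), lscale = (*\<^sub>R),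
     lbracket = (\<lambda>(X0, X1) (Y0, Y1). ((X0 o\<^sub>L Y0) - (Y0 o\<^sub>L X0), (X1 o\<^sub>L Y1) - (Y1 o\<^sub>L X1)))\<rparr>"

definition delta ::
  "('b::real_normed_vector \<Rightarrow>\<^sub>L 'a::real_normed_vector) \<Rightarrow> ('a \<Rightarrow>\<^sub>L 'b)
     \<Rightarrow> ('a \<Rightarrow>\<^sub>L 'a) \<times> ('b \<Rightarrow>\<^sub>L 'b)" where
  "delta d A = (d o\<^sub>L A, A o\<^sub>L d)"

definition phi ::
  "('a::real_normed_vector \<Rightarrow>\<^sub>L 'a) \<times> ('b::real_normed_vector \<Rightarrow>\<^sub>L 'b)
     \<Rightarrow> ('a \<Rightarrow>\<^sub>L 'b) \<Rightarrow> ('a \<Rightarrow>\<^sub>L 'b)" where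
  "phi = (\<lambda>(X0, X1) A. (X1 o\<^sub>L A) - (A o\<^sub>L X0))"

definition End_xmod ::
  "('b::real_normed_vector \<Rightarrow>\<^sub>L 'a::real_normed_vector)
     \<Rightarrow> ('a \<Rightarrow>\<^sub>L 'b, ('a \<Rightarrow>\<^sub>L 'a) \<times> ('b \<Rightarrow>\<^sub>L 'b)) lie_alg_xmod" where
  "End_xmod d = (k1 d, k0 d, delta d, phi)"

text \<open>As for \<open>k0\<close>, a block diagonal matrix is represented by the pair of its diagonal blocks;
  \<open>block_diag\<close> is the corresponding operator on \<open>V\<^sub>0 \<oplus> V\<^sub>1\<close>.\<close>

definition int_delta ::
  "('b::real_normed_vector \<Rightarrow>\<^sub>L 'a::real_normed_vector) \<Rightarrow> ('a \<Rightarrow>\<^sub>L 'b)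
     \<Rightarrow> ('a \<Rightarrow>\<^sub>L 'a) \<times> ('b \<Rightarrow>\<^sub>L 'b)" where
  "int_delta d M = (id_blinfun + (d o\<^sub>L M), (M o\<^sub>L d) + id_blinfun)"

definition K1_set ::
  "('b::real_normed_vector \<Rightarrow>\<^sub>L 'a::real_normed_vector) \<Rightarrow> ('a \<Rightarrow>\<^sub>L 'b) set" where
  "K1_set d = {M. block_diag (int_delta d M) \<in> GL}"

definition K1 ::
  "('b::real_normed_vector \<Rightarrow>\<^sub>L 'a::real_normed_vector) \<Rightarrow> ('a \<Rightarrow>\<^sub>L 'b, 'a \<Rightarrow>\<^sub>L 'b) lie_grp" where
  "K1 d = \<lparr>carrier = K1_set d,
     monoid.mult = (\<lambda>M1 M2. M1 + M2 + (M1 o\<^sub>L d o\<^sub>L M2)),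
     one = 0,
     mfd = open_submanifold UNIV (K1_set d)\<rparr>"

definition K0_set ::
  "('b::real_normed_vector \<Rightarrow>\<^sub>L 'a::real_normed_vector) \<Rightarrow> (('a \<Rightarrow>\<^sub>L 'a) \<times> ('b \<Rightarrow>\<^sub>L 'b)) set" where
  "K0_set d = {(B0, B1). B0 \<in> GL \<and> B1 \<in> GL \<and> B0 o\<^sub>L d = d o\<^sub>L B1}"

definition K0 ::
  "('b::real_normed_vector \<Rightarrow>\<^sub>L 'a::real_normed_vector)
     \<Rightarrow> (('a \<Rightarrow>\<^sub>L 'a) \<times> ('b \<Rightarrow>\<^sub>L 'b), ('a \<Rightarrow>\<^sub>L 'a) \<times> ('b \<Rightarrow>\<^sub>L 'b)) lie_grp" where
  "K0 d = \<lparr>carrier = K0_set d,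
     monoid.mult = (\<lambda>(A0, A1) (B0, B1). (A0 o\<^sub>L B0, A1 o\<^sub>L B1)),
     one = (id_blinfun, id_blinfun),
     mfd = open_submanifold (lcarrier (k0 d)) (K0_set d)\<rparr>"

definition Phi ::
  "('a::real_normed_vector \<Rightarrow>\<^sub>L 'a) \<times> ('b::real_normed_vector \<Rightarrow>\<^sub>L 'b)
     \<Rightarrow> ('a \<Rightarrow>\<^sub>L 'b) \<Rightarrow> ('a \<Rightarrow>\<^sub>L 'b)" where
  "Phi = (\<lambda>(B0, B1) M. B1 o\<^sub>L M o\<^sub>L GL_inv B0)"

definition Aut_xmod ::
  "('b::real_normed_vector \<Rightarrow>\<^sub>L 'a::real_normed_vector)
     \<Rightarrow> ('a \<Rightarrow>\<^sub>L 'b, 'a \<Rightarrow>\<^sub>L 'b, ('a \<Rightarrow>\<^sub>L 'a) \<times> ('b \<Rightarrow>\<^sub>L 'b), ('a \<Rightarrow>\<^sub>L 'a) \<times> ('b \<Rightarrow>\<^sub>L 'b)) lie_grp_xmod" where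
  "Aut_xmod d = (K1 d, K0 d, int_delta d, Phi)"

end

theory Submission
  imports Defs
begin

text \<open>Both groups are relatively open subsets of linear spaces, so each is covered by one chart, a
  tangent vector is a vector of the model space, and the bracket of left-invariant fields is the
  antisymmetrized mixed second derivative of the multiplication at the identity. All structure maps
  are built from linear maps, composition of operators and operator inversion; the latter is smooth
  because its derivative \<open>H \<mapsto> - T\<inverse> H T\<inverse>\<close> is again of this form.
  The group \<open>K\<^sub>1\<close> is understood through \<open>\<integral>\<delta>\<close>, which turns its multiplication into
  composition: \<open>I + d (M\<^sub>1 \<cdot> M\<^sub>2) = (I + d M\<^sub>1) (I + d M\<^sub>2)\<close>, and likewise for \<open>M d + I\<close>.
  The crossed module of Lie algebras of \<open>Aut\<close> inherits its axioms from \<open>End\<close> along the tangent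
  coordinates.\<close>

section \<open>Finite-dimensional spaces\<close>

text \<open>Two obstacles shape the proof. The spaces are bare normed spaces whose finite dimension
  is a hypothesis, and \<open>K0_set d\<close> is open only in the subspace
  \<open>lcarrier (k0 d)\<close>, which is not a type. Finite dimension is therefore carried from V0
  and V1 to products and operator spaces by means of spanning sets; it then supplies second
  countability of the manifolds and openness of \<open>GL\<close>. Derivatives are taken within a
  set \<open>S\<close> that is open in a subspace \<open>E\<close>. Such a derivative is in general
  not unique as a map on the whole type, but its values on \<open>E\<close> are, and only these
  enter \<open>Ck_on\<close>, tangent vectors and brackets.\<close>

lemma finite_dim_subset:
  fixes E F :: "'m::real_vector set"
  assumes "finite_dim E" "subspace F" "F \<subseteq> E"
  shows "finite_dim F"
proof -
  obtain B where B: "finite B" "span B = E"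
    using assms by (auto simp: finite_dim_def)
  obtain C where C: "C \<subseteq> F" "independent C" "F \<subseteq> span C"
    using maximal_independent_subset by blast
  have "finite C"
    using independent_span_bound[OF B(1) C(2)] C(1) assms(3) B(2) by auto
  moreover have "span C = F"
    using C assms(2) by (metis span_minimal subset_antisym)
  ultimately show ?thesis
    by (auto simp: finite_dim_def)
qed

text \<open>Rank-nullity without counting dimensions: preimages of a spanning set of the image,
  joined to a spanning set of the kernel, span \<open>W\<close>. The results for products and
  operator spaces both reduce to this.\<close>

lemma finite_dim_kernel_image:
  fixes f :: "'m::real_vector \<Rightarrow> 'n::real_vector"
  assumes f: "linear f" and W: "subspace W"
    and ker: "finite_dim {x\<in>W. f x = 0}" and im: "finite_dim (f ` W)"
  shows "finite_dim W"
proof -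
  obtain K where K: "finite K" "span K = {x\<in>W. f x = 0}"
    using ker by (auto simp: finite_dim_def)
  obtain C where C: "finite C" "span C = f ` W"
    using im by (auto simp: finite_dim_def)
  have "C \<subseteq> f ` W"
    using C(2) span_superset by blast
  then obtain P where P: "P \<subseteq> W" "finite P" "C = f ` P"
    using C(1) finite_subset_image by metis
  have "x \<in> span (K \<union> P)" if "x \<in> W" for x
  proof -
    have "f x \<in> f ` span P"
      using that C(2) P(3) linear_span_image[OF f, of P] by auto
    then obtain p where p: "p \<in> span P" "f x = f p"
      by auto
    have "p \<in> W"
      using p(1) P(1) W span_minimal by blast
    then have "x - p \<in> span K"
      using that p(2) K(2) W f by (simp add: subspace_diff linear_diff)
    then have "(x - p) + p \<in> span (K \<union> P)"
      using p(1) by (meson span_add span_mono subsetD sup_ge1 sup_ge2)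
    then show ?thesis by simp
  qed
  moreover have "span (K \<union> P) \<subseteq> W"
    using K(2) P(1) W span_superset[of K] by (intro span_minimal) auto
  ultimately show ?thesis
    using K(1) P(2) unfolding finite_dim_def by (meson finite_UnI subset_antisym subsetI)
qed

lemma finite_dim_zero: "finite_dim {0}"
  unfolding finite_dim_def by (rule exI[of _ "{}"]) auto

text \<open>One factor is projected away at a time: the kernel of \<open>fst\<close> is treated in
  turn by \<open>snd\<close>, whose kernel inside it is zero.\<close>

lemma finite_dim_prod:
  assumes "finite_dim (UNIV :: 'm::real_vector set)" "finite_dim (UNIV :: 'n::real_vector set)"
  shows "finite_dim (UNIV :: ('m \<times> 'n) set)"
proof (rule finite_dim_kernel_image[where f = fst])
  have "{x \<in> {x :: 'm \<times> 'n. fst x = 0}. snd x = 0} = {0}"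
    by (auto simp: zero_prod_def)
  then have "finite_dim {x \<in> {x :: 'm \<times> 'n. fst x = 0}. snd x = 0}"
    using finite_dim_zero by metis
  moreover have "subspace {x :: 'm \<times> 'n. fst x = 0}"
    by (auto simp: subspace_def)
  moreover have "finite_dim (snd ` {x :: 'm \<times> 'n. fst x = 0})"
    using calculation(2) by (intro finite_dim_subset[OF assms(2)] linear_subspace_image linear_snd) auto
  ultimately show "finite_dim {x \<in> (UNIV :: ('m \<times> 'n) set). fst x = 0}"
    using finite_dim_kernel_image[where f = snd and W = "{x :: 'm \<times> 'n. fst x = 0}"]
    by (simp add: linear_snd)
qed (use assms in \<open>auto simp: linear_fst\<close>)

lemma finite_dim_blinfun:
  assumes fin: "finite_dim (UNIV :: 'm::real_normed_vector set)"
      "finite_dim (UNIV :: 'n::real_normed_vector set)"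
  shows "finite_dim (UNIV :: ('m \<Rightarrow>\<^sub>L 'n) set)"
proof -
  obtain B :: "'m set" where B: "finite B" "span B = UNIV"
    using fin(1) by (auto simp: finite_dim_def)
  \<comment> \<open>Filter the operators by the vanishing on more and more basis vectors; consecutive steps differ
    by an evaluation map, so no bound on coordinate functionals is needed.\<close>
  let ?W = "\<lambda>S. {T :: 'm \<Rightarrow>\<^sub>L 'n. \<forall>b\<in>S. T b = 0}"
  have sub: "subspace (?W S)" for S
    by (auto simp: subspace_def blinfun.bilinear_simps)
  have "finite_dim (?W (B - S))" if "finite S" for S
    using that
  proof induction
    case empty
    have "T = 0" if "T \<in> ?W B" for T
    proof (rule blinfun_eqI)
      fix x
      have "x \<in> span B" using B(2) by simp
      then show "blinfun_apply T x = blinfun_apply 0 x"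
        using that by (induction rule: span_induct) (auto simp: subspace_def blinfun.bilinear_simps)
    qed
    then have "?W B = {0}" by auto
    then show ?case using finite_dim_zero by simp
  next
    case (insert b S)
    let ?e = "\<lambda>T :: 'm \<Rightarrow>\<^sub>L 'n. T b"
    have lin: "linear ?e"
      by (rule linearI) (simp_all add: blinfun.bilinear_simps)
    have "{T \<in> ?W (B - insert b S). ?e T = 0} \<subseteq> ?W (B - S)"
      by auto
    moreover have "subspace {T \<in> ?W (B - insert b S). ?e T = 0}"
      by (auto simp: subspace_def blinfun.bilinear_simps)
    moreover have "finite_dim (?e ` ?W (B - insert b S))"
      by (intro finite_dim_subset[OF fin(2)] linear_subspace_image[OF lin sub]) auto
    ultimately show ?case
      by (intro finite_dim_kernel_image[OF lin sub] finite_dim_subset[OF insert.IH])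
  qed
  from this[OF B(1)] show ?thesis by simp
qed

text \<open>Combinations with rational coefficients are dense: each new generator receives one
  rational coefficient, and the rest falls to the induction hypothesis. This is the source of second
  countability.\<close>

lemma countable_dense_span:
  fixes B :: "'m::real_normed_vector set"
  assumes "finite B"
  shows "\<exists>D. countable D \<and> (\<forall>x\<in>span B. \<forall>e>0. \<exists>y\<in>D. dist y x < e)"
  using assms
proof induction
  case empty
  show ?case by (rule exI[of _ "{0}"]) auto
next
  case (insert b B)
  then obtain D where D: "countable D" "\<And>x e. x \<in> span B \<Longrightarrow> e > 0 \<Longrightarrow> \<exists>y\<in>D. dist y x < e"
    by blast
  have "\<exists>y\<in>(\<lambda>(q, y). q *\<^sub>R b + y) ` (\<rat> \<times> D). dist y x < e"
    if xe: "x \<in> span (insert b B)" "e > 0" for x e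
  proof -
    obtain k where k: "x - k *\<^sub>R b \<in> span B"
      using xe(1) span_breakdown_eq[of x b B] by blast
    obtain y where y: "y \<in> D" "dist y (x - k *\<^sub>R b) < e / 2"
      using D(2)[OF k, of "e/2"] xe(2) by auto
    \<comment> \<open>Half of \<open>e\<close> is reserved for the error in the coefficient of
      \<open>b\<close>; adding 1 keeps the denominator positive when \<open>b\<close> is
      zero.\<close>
    define r where "r = e / (2 * (norm b + 1))"
    have "r > 0"
      using xe(2) by (simp add: r_def add_nonneg_pos)
    then obtain q where q: "q \<in> \<rat>" "k < q" "q < k + r"
      using Rats_dense_in_real[of k "k + r"] by auto
    have "\<bar>q - k\<bar> * norm b \<le> r * norm b"
      using q by (intro mult_right_mono) auto
    also have "\<dots> \<le> e / 2"
    proof -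
      have "norm b / (norm b + 1) \<le> 1"
        by (simp add: divide_le_eq_1 add_nonneg_pos)
      then have "e / 2 * (norm b / (norm b + 1)) \<le> e / 2 * 1"
        using xe(2) by (intro mult_left_mono) auto
      then show ?thesis
        by (simp add: r_def)
    qed
    finally have "norm ((q - k) *\<^sub>R b) \<le> e / 2" by simp
    moreover have eq: "(q *\<^sub>R b + y) - x = (q - k) *\<^sub>R b + (y - (x - k *\<^sub>R b))"
      by (simp add: algebra_simps)
    ultimately have "dist (q *\<^sub>R b + y) x < e"
      using y(2) norm_triangle_ineq[of "(q - k) *\<^sub>R b" "y - (x - k *\<^sub>R b)"]
      unfolding dist_norm eq by linarith
    then show ?thesis
      using q y by force
  qed
  moreover have "countable ((\<lambda>(q, y). q *\<^sub>R b + y) ` (\<rat> \<times> D))"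
    using D(1) countable_rat by auto
  ultimately show ?case by blast
qed

lemma second_countable_finite_dim:
  assumes "finite_dim (UNIV :: 'm::real_normed_vector set)"
  shows "second_countable (top_of_set (S :: 'm set))"
proof -
  obtain B :: "'m set" where B: "finite B" "span B = UNIV"
    using assms by (auto simp: finite_dim_def)
  from countable_dense_span[OF B(1)]
  obtain D :: "'m set" where D: "countable D" "\<forall>x. \<forall>e>0. \<exists>y\<in>D. dist y x < e"
    by (auto simp: B(2))
  let ?B = "(\<lambda>(y, q). ball y q) ` (D \<times> \<rat>)"
  have "\<exists>V\<in>?B. x \<in> V \<and> V \<subseteq> U" if U: "open U" "x \<in> U" for U and x :: 'm
  proof -
    obtain e where e: "e > 0" "ball x e \<subseteq> U"
      using U open_contains_ball by blast
    \<comment> \<open>Two points of a ball of radius \<open>q\<close> are less than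
      \<open>2 * q < e\<close> apart, so such a ball stays in \<open>ball x e\<close> once it
      contains \<open>x\<close>.\<close>
    obtain q where q: "q \<in> \<rat>" "0 < q" "q < e / 2"
      using Rats_dense_in_real[of 0 "e / 2"] e(1) by auto
    obtain y where y: "y \<in> D" "dist y x < q"
      using D(2) q(2) by blast
    have "ball y q \<subseteq> ball x e"
    proof
      fix z assume "z \<in> ball y q"
      then have "dist x z < e"
        using y(2) q(3) dist_triangle[of x z y] by (simp add: dist_commute)
      then show "z \<in> ball x e" by simp
    qed
    then show ?thesis
      using y q(1) e(2) by (intro bexI[of _ "ball y q"] conjI image_eqI[of _ _ "(y, q)"]) auto
  qed
  then have "second_countable (euclidean :: 'm topology)"
    unfolding second_countable_def using D(1) countable_rat by (intro exI[of _ ?B]) auto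
  then show ?thesis
    by (rule second_countable_subtopology)
qed

lemma finite_dim_inj_imp_surj:
  fixes f :: "'m::real_vector \<Rightarrow> 'm"
  assumes "finite_dim (UNIV :: 'm set)" "linear f" "inj f"
  shows "surj f"
proof -
  obtain B0 :: "'m set" where B0: "finite B0" "span B0 = UNIV"
    using assms(1) by (auto simp: finite_dim_def)
  \<comment> \<open>The given spanning set may be dependent. The theory of finite-dimensional spaces
    asks for a basis, and the exchange bound against \<open>B0\<close> makes this one
    finite.\<close>
  obtain B :: "'m set" where B: "independent B" "span B = UNIV"
    using maximal_independent_subset[of "UNIV :: 'm set"] by (metis top.extremum_unique)
  have "finite B"
    using independent_span_bound[OF B0(1) B(1)] B0(2) by auto
  then interpret finite_dimensional_vector_space "scaleR :: real \<Rightarrow> 'm \<Rightarrow> 'm" B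
    using B by unfold_locales (auto simp: dependent_raw_def span_raw_def)
  show ?thesis
    using linear_inj_imp_surj assms(2,3) by (simp add: linear_def)
qed

section \<open>Calculus of smooth maps\<close>

lemma eventually_line_in:
  fixes E :: "'m::real_normed_vector set"
  assumes "subspace E" "openin (top_of_set E) S" "x \<in> S" "v \<in> E"
  shows "\<forall>\<^sub>F t in nhds 0. x + t *\<^sub>R v \<in> S"
proof -
  obtain U where U: "open U" "S = E \<inter> U"
    using assms(2) by (auto simp: openin_open)
  have "((\<lambda>t. x + t *\<^sub>R v) \<longlongrightarrow> x + 0 *\<^sub>R v) (nhds 0)"
    by (intro tendsto_intros filterlim_ident)
  then have "\<forall>\<^sub>F t in nhds 0. x + t *\<^sub>R v \<in> U"
    using U assms(3) by (intro topological_tendstoD) auto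
  then show ?thesis
    by (rule eventually_mono) (use U assms in \<open>auto intro: subspace_add subspace_scale\<close>)
qed

lemma dirderiv_eqI:
  fixes f :: "'m::real_normed_vector \<Rightarrow> 'n::real_normed_vector"
  assumes "subspace E" "openin (top_of_set E) S" "x \<in> S" "v \<in> E"
    and D: "(f has_derivative D) (at x within S)"
  shows "dirderiv f x v = D v"
proof -
  let ?T = "{t. x + t *\<^sub>R v \<in> S}"
  interpret D: bounded_linear D
    using D by (rule has_derivative_bounded_linear)
  have ev: "\<forall>\<^sub>F t in nhds 0. t \<in> ?T"
    using eventually_line_in[OF assms(1-4)] by simp
  have "((\<lambda>t. x + t *\<^sub>R v) has_derivative (\<lambda>h. h *\<^sub>R v)) (at 0 within ?T)"
    by (auto intro!: derivative_eq_intros)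
  moreover have "(f has_derivative D) (at (x + 0 *\<^sub>R v) within (\<lambda>t. x + t *\<^sub>R v) ` ?T)"
    using D by (auto intro: has_derivative_subset)
  ultimately have "((\<lambda>t. f (x + t *\<^sub>R v)) has_derivative (\<lambda>h. D (h *\<^sub>R v))) (at 0 within ?T)"
    by (rule has_derivative_in_compose)
  moreover have "0 \<in> interior ?T"
    using ev by (auto simp: eventually_nhds interior_def)
  ultimately have "((\<lambda>t. f (x + t *\<^sub>R v)) has_vector_derivative D v) (at 0)"
    unfolding has_vector_derivative_def D.scaleR by (metis at_within_interior)
  then show ?thesis
    by (simp add: dirderiv_def vector_derivative_at)
qed

lemma dirderiv_cong:
  assumes "subspace E" "openin (top_of_set E) S" "x \<in> S" "v \<in> E"
    and eq: "\<And>y. y \<in> S \<Longrightarrow> f y = g y"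
  shows "dirderiv f x v = dirderiv g x v"
  unfolding dirderiv_def
proof (rule vector_derivative_cong_eq)
  show "\<forall>\<^sub>F t in nhds 0. t \<in> UNIV \<longrightarrow> f (x + t *\<^sub>R v) = g (x + t *\<^sub>R v)"
    using eventually_line_in[OF assms(1-4)] by (rule eventually_mono) (simp add: eq)
qed simp_all

context
  fixes E S :: "'m::real_normed_vector set"
  assumes E: "subspace E" and S: "openin (top_of_set E) S"
begin

lemma Ck_on_cong:
  assumes "\<And>y. y \<in> S \<Longrightarrow> f y = g y"
  shows "Ck_on k E S f \<longleftrightarrow> Ck_on k E S g"
  using assms
proof (induction k arbitrary: f g)
  case 0
  then show ?case by (simp cong: continuous_on_cong)
next
  case (Suc k)
  have "f differentiable_on S \<longleftrightarrow> g differentiable_on S"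
    using differentiable_transform_within[of f _ S 1 g] differentiable_transform_within[of g _ S 1 f]
      Suc.prems unfolding differentiable_on_def by auto
  moreover have "Ck_on k E S (\<lambda>x. dirderiv f x v) \<longleftrightarrow> Ck_on k E S (\<lambda>x. dirderiv g x v)"
    if "v \<in> E" for v
  proof (rule Suc.IH)
    show "dirderiv f y v = dirderiv g y v" if "y \<in> S" for y
      by (rule dirderiv_cong[OF E S \<open>y \<in> S\<close> \<open>v \<in> E\<close>]) (rule Suc.prems)
  qed
  ultimately show ?case by simp
qed

text \<open>This rule and its converse trade the iterated \<open>dirderiv\<close> of the definition
  for any Frechet derivative within \<open>S\<close>. The closure rules below thereby become
  ordinary differentiation rules combined with induction on the order.\<close>

lemma Ck_on_SucI:
  assumes "\<And>x. x \<in> S \<Longrightarrow> (f has_derivative D x) (at x within S)"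
    and "\<And>v. v \<in> E \<Longrightarrow> Ck_on k E S (\<lambda>x. D x v)"
  shows "Ck_on (Suc k) E S f"
proof -
  have "Ck_on k E S (\<lambda>x. dirderiv f x v) \<longleftrightarrow> Ck_on k E S (\<lambda>x. D x v)" if "v \<in> E" for v
    using dirderiv_eqI[OF E S _ that assms(1)] by (intro Ck_on_cong) auto
  then show ?thesis
    using assms by (auto simp: differentiable_on_def differentiable_def)
qed

lemma Ck_on_SucE:
  assumes "Ck_on (Suc k) E S f"
  obtains D where "\<And>x. x \<in> S \<Longrightarrow> (f has_derivative D x) (at x within S)"
    and "\<And>v. v \<in> E \<Longrightarrow> Ck_on k E S (\<lambda>x. D x v)"
proof
  let ?D = "\<lambda>x. frechet_derivative f (at x within S)"
  show der: "(f has_derivative ?D x) (at x within S)" if "x \<in> S" for x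
    using assms that by (auto simp: differentiable_on_def frechet_derivative_works)
  show "Ck_on k E S (\<lambda>x. ?D x v)" if v: "v \<in> E" for v
  proof -
    have "Ck_on k E S (\<lambda>x. dirderiv f x v) \<longleftrightarrow> Ck_on k E S (\<lambda>x. ?D x v)"
      using dirderiv_eqI[OF E S _ v der] by (intro Ck_on_cong) auto
    then show ?thesis
      using assms v by simp
  qed
qed

text \<open>For product rules: the derivative contains the undifferentiated factors again, and the
  induction hypothesis asks for them at the lower order.\<close>

lemma Ck_on_SucD: "Ck_on (Suc k) E S f \<Longrightarrow> Ck_on k E S f"
proof (induction k arbitrary: f)
  case 0
  then show ?case by (simp add: differentiable_imp_continuous_on)
next
  case (Suc k)
  show ?case
    unfolding Ck_on.simps(2)[of k]
    using Suc.IH Suc.prems Ck_on.simps(2)[of "Suc k" E S f] by blast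
qed

section \<open>Closure properties of C^k maps\<close>

lemma Ck_on_const: "Ck_on k E S (\<lambda>x. c)"
proof (induction k arbitrary: c)
  case (Suc k)
  show ?case
    by (rule Ck_on_SucI[where D = "\<lambda>x h. 0"]) (auto intro: Suc.IH)
qed simp

lemma Ck_on_bounded_linear:
  assumes "bounded_linear L"
  shows "Ck_on k E S L"
proof (cases k)
  case 0
  then show ?thesis
    using assms by (simp add: linear_continuous_on)
next
  case (Suc j)
  then show ?thesis
    using Ck_on_SucI[where D = "\<lambda>x. L" and f = L] bounded_linear_imp_has_derivative[OF assms]
      Ck_on_const by auto
qed

lemma Ck_on_add:
  assumes "Ck_on k E S f" "Ck_on k E S g"
  shows "Ck_on k E S (\<lambda>x. f x + g x)"
  using assms
proof (induction k arbitrary: f g)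
  case 0
  then show ?case by (simp add: continuous_on_add)
next
  case (Suc k)
  obtain D where D: "\<And>x. x \<in> S \<Longrightarrow> (f has_derivative D x) (at x within S)"
      "\<And>v. v \<in> E \<Longrightarrow> Ck_on k E S (\<lambda>x. D x v)"
    using Ck_on_SucE[OF Suc.prems(1)] by blast
  obtain D' where D': "\<And>x. x \<in> S \<Longrightarrow> (g has_derivative D' x) (at x within S)"
      "\<And>v. v \<in> E \<Longrightarrow> Ck_on k E S (\<lambda>x. D' x v)"
    using Ck_on_SucE[OF Suc.prems(2)] by blast
  show ?case
    by (rule Ck_on_SucI[where D = "\<lambda>x h. D x h + D' x h"])
      (auto intro!: Suc.IH D D' has_derivative_add)
qed

lemma Ck_on_bilinear:
  assumes "bounded_bilinear p" "Ck_on k E S f" "Ck_on k E S g"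
  shows "Ck_on k E S (\<lambda>x. p (f x) (g x))"
  using assms(2,3)
proof (induction k arbitrary: f g)
  case 0
  then show ?case
    by (simp add: bounded_bilinear.continuous_on[OF assms(1)])
next
  case (Suc k)
  obtain D where D: "\<And>x. x \<in> S \<Longrightarrow> (f has_derivative D x) (at x within S)"
      "\<And>v. v \<in> E \<Longrightarrow> Ck_on k E S (\<lambda>x. D x v)"
    using Ck_on_SucE[OF Suc.prems(1)] by blast
  obtain D' where D': "\<And>x. x \<in> S \<Longrightarrow> (g has_derivative D' x) (at x within S)"
      "\<And>v. v \<in> E \<Longrightarrow> Ck_on k E S (\<lambda>x. D' x v)"
    using Ck_on_SucE[OF Suc.prems(2)] by blast
  show ?case
    by (rule Ck_on_SucI[where D = "\<lambda>x h. p (f x) (D' x h) + p (D x h) (g x)"])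
      (auto intro!: Suc.IH Ck_on_add Ck_on_SucD[OF Suc.prems(1)] Ck_on_SucD[OF Suc.prems(2)]
        D D' bounded_bilinear.FDERIV[OF assms(1)])
qed

lemma Ck_on_compose_linear:
  assumes "bounded_linear L" "Ck_on k E S f"
  shows "Ck_on k E S (\<lambda>x. L (f x))"
  using assms(2)
proof (induction k arbitrary: f)
  case 0
  then show ?case
    using assms(1) by (simp add: bounded_linear.continuous_on)
next
  case (Suc k)
  obtain D where D: "\<And>x. x \<in> S \<Longrightarrow> (f has_derivative D x) (at x within S)"
      "\<And>v. v \<in> E \<Longrightarrow> Ck_on k E S (\<lambda>x. D x v)"
    using Ck_on_SucE[OF Suc.prems] by blast
  show ?case
    by (rule Ck_on_SucI[where D = "\<lambda>x h. L (D x h)"])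
      (auto intro!: Suc.IH D bounded_linear.has_derivative[OF assms(1)])
qed

section \<open>Closure properties of smooth maps\<close>

lemma smooth_on_cong:
  assumes "\<And>y. y \<in> S \<Longrightarrow> f y = g y"
  shows "smooth_on E S f \<longleftrightarrow> smooth_on E S g"
  using Ck_on_cong[OF assms] by (auto simp: smooth_on_def)

lemma smooth_on_const: "smooth_on E S (\<lambda>x. c)"
  by (simp add: smooth_on_def Ck_on_const)

lemma smooth_on_bounded_linear: "bounded_linear L \<Longrightarrow> smooth_on E S L"
  by (simp add: smooth_on_def Ck_on_bounded_linear)

lemma smooth_on_compose_linear:
  "bounded_linear L \<Longrightarrow> smooth_on E S f \<Longrightarrow> smooth_on E S (\<lambda>x. L (f x))"
  by (simp add: smooth_on_def Ck_on_compose_linear)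

lemma smooth_on_add:
  "smooth_on E S f \<Longrightarrow> smooth_on E S g \<Longrightarrow> smooth_on E S (\<lambda>x. f x + g x)"
  by (simp add: smooth_on_def Ck_on_add)

lemma smooth_on_uminus: "smooth_on E S f \<Longrightarrow> smooth_on E S (\<lambda>x. - f x)"
  by (rule smooth_on_compose_linear[OF bounded_linear_minus[OF bounded_linear_ident]])

lemma smooth_on_bilinear:
  "bounded_bilinear p \<Longrightarrow> smooth_on E S f \<Longrightarrow> smooth_on E S g \<Longrightarrow> smooth_on E S (\<lambda>x. p (f x) (g x))"
  by (simp add: smooth_on_def Ck_on_bilinear)

lemmas smooth_on_blinfun_compose = smooth_on_bilinear[OF bounded_bilinear_blinfun_compose]

lemma smooth_on_Pair:
  assumes "smooth_on E S f" "smooth_on E S g"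
  shows "smooth_on E S (\<lambda>x. (f x, g x))"
proof -
  \<comment> \<open>A pair is a sum of two bounded linear images, so the rules for sums and linear
    maps cover it.\<close>
  have "smooth_on E S (\<lambda>x. (f x, 0) + (0, g x))"
    by (rule smooth_on_add[OF
          smooth_on_compose_linear[OF bounded_linear_Pair[OF bounded_linear_ident bounded_linear_zero]]
          smooth_on_compose_linear[OF bounded_linear_Pair[OF bounded_linear_zero bounded_linear_ident]]])
      (rule assms)+
  then show ?thesis by simp
qed

end

section \<open>The general linear group\<close>

lemma blinfun_compose_monoid:
  "(f o\<^sub>L g) o\<^sub>L h = f o\<^sub>L (g o\<^sub>L h)" "id_blinfun o\<^sub>L f = f" "f o\<^sub>L id_blinfun = f"
  by (auto intro: blinfun_eqI)

text \<open>Two-sided inverses are unique in a monoid, which makes the definite description in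
  \<open>GL_inv\<close> meaningful.\<close>

lemma GL_inv_props:
  assumes "T \<in> GL"
  shows "GL_inv T o\<^sub>L T = id_blinfun" "T o\<^sub>L GL_inv T = id_blinfun"
proof -
  obtain S where S: "S o\<^sub>L T = id_blinfun" "T o\<^sub>L S = id_blinfun"
    using assms by (auto simp: GL_def)
  have "S' = S" if "S' o\<^sub>L T = id_blinfun \<and> T o\<^sub>L S' = id_blinfun" for S'
  proof -
    have "S' = S' o\<^sub>L (T o\<^sub>L S)"
      by (simp add: S blinfun_compose_monoid)
    also have "\<dots> = (S' o\<^sub>L T) o\<^sub>L S"
      by (simp only: blinfun_compose_monoid(1))
    also have "\<dots> = S"
      using that by (simp add: blinfun_compose_monoid(2))
    finally show ?thesis .
  qed
  with S have "\<exists>!S. S o\<^sub>L T = id_blinfun \<and> T o\<^sub>L S = id_blinfun"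
    by blast
  then have "GL_inv T o\<^sub>L T = id_blinfun \<and> T o\<^sub>L GL_inv T = id_blinfun"
    unfolding GL_inv_def by (rule theI')
  then show "GL_inv T o\<^sub>L T = id_blinfun" "T o\<^sub>L GL_inv T = id_blinfun" by auto
qed

lemma GL_inv_apply [simp]:
  assumes "T \<in> GL"
  shows "GL_inv T (T x) = x" "T (GL_inv T x) = x"
  using GL_inv_props[OF assms, THEN arg_cong, of "\<lambda>T. blinfun_apply T x"] by simp_all

lemma GL_inv_unique:
  assumes "S o\<^sub>L T = id_blinfun" "T o\<^sub>L S = id_blinfun"
  shows "T \<in> GL" "GL_inv T = S"
proof -
  show T: "T \<in> GL"
    using assms by (auto simp: GL_def)
  show "GL_inv T = S"
  proof (rule blinfun_eqI)
    fix x
    have "GL_inv T x = GL_inv T ((T o\<^sub>L S) x)"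
      by (simp add: assms(2))
    then show "GL_inv T x = S x"
      using T by simp
  qed
qed

lemma GL_id: "id_blinfun \<in> GL"
  by (rule GL_inv_unique(1)[of id_blinfun]) (auto intro: blinfun_eqI)

lemma GL_inv_id [simp]: "GL_inv id_blinfun = id_blinfun"
  by (rule GL_inv_unique) (auto intro: blinfun_eqI)

lemma GL_compose:
  assumes "S \<in> GL" "T \<in> GL"
  shows "S o\<^sub>L T \<in> GL" "GL_inv (S o\<^sub>L T) = GL_inv T o\<^sub>L GL_inv S"
proof -
  have "(GL_inv T o\<^sub>L GL_inv S) o\<^sub>L (S o\<^sub>L T) = id_blinfun"
    "(S o\<^sub>L T) o\<^sub>L (GL_inv T o\<^sub>L GL_inv S) = id_blinfun"
    using assms by (auto intro: blinfun_eqI)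
  from GL_inv_unique[OF this]
  show "S o\<^sub>L T \<in> GL" "GL_inv (S o\<^sub>L T) = GL_inv T o\<^sub>L GL_inv S" .
qed

lemma GL_GL_inv:
  assumes "T \<in> GL"
  shows "GL_inv T \<in> GL" "GL_inv (GL_inv T) = T"
  using GL_inv_unique[OF GL_inv_props(2,1)[OF assms]] .

text \<open>Injectivity gives surjectivity by dimension, and the lower bound makes the inverse bounded; this
  replaces the Neumann series, as the spaces are not known to be complete.\<close>

lemma GL_bounded_below:
  fixes T :: "'v::real_normed_vector \<Rightarrow>\<^sub>L 'v"
  assumes fin: "finite_dim (UNIV :: 'v set)" and c: "c > 0" "\<And>x. c * norm x \<le> norm (T x)"
  shows "T \<in> GL"
proof -
  have lin: "linear T"
    by (rule linearI) (simp_all add: blinfun.bilinear_simps)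
  have inj: "inj T"
    using c by (intro linear_injective_0[OF lin, THEN iffD2]) 
      (metis dual_order.antisym mult_le_0_iff norm_eq_zero norm_ge_zero norm_zero not_less)
  then have bij: "bij T"
    using finite_dim_inj_imp_surj[OF fin lin] by (simp add: bij_def)
  let ?g = "inv_into UNIV T"
  have Tg: "T (?g y) = y" for y
    using bij by (simp add: bij_is_surj surj_f_inv_f)
  have gT: "?g (T x) = x" for x
    using inj by simp
  have "bounded_linear ?g"
  proof (rule bounded_linear_intro)
    show "?g (x + y) = ?g x + ?g y" for x y
      using gT[of "?g x + ?g y"] by (simp add: blinfun.add_right Tg)
    show "?g (r *\<^sub>R x) = r *\<^sub>R ?g x" for r x
      using gT[of "r *\<^sub>R ?g x"] by (simp add: blinfun.scaleR_right Tg)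
    show "norm (?g x) \<le> norm x * inverse c" for x
      using c(1) c(2)[of "?g x"] by (simp add: Tg field_simps)
  qed
  then show ?thesis
    by (intro GL_inv_unique(1)[of "Blinfun ?g"])
      (auto intro!: blinfun_eqI simp: bounded_linear_Blinfun_apply Tg gT)
qed

text \<open>An invertible \<open>T\<close> is bounded below. A perturbation smaller than half of
  that bound leaves the other half, and a positive lower bound already forces invertibility.\<close>

lemma open_GL:
  assumes fin: "finite_dim (UNIV :: 'v::real_normed_vector set)"
  shows "open (GL :: ('v \<Rightarrow>\<^sub>L 'v) set)"
  unfolding open_dist
proof (intro ballI)
  fix T :: "'v \<Rightarrow>\<^sub>L 'v"
  assume T: "T \<in> GL"
  \<comment> \<open>The lower bound of \<open>T\<close> is \<open>1 / n\<close>. Adding 1 keeps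
    \<open>n\<close> positive on the zero space too, where the inverse has norm 0.\<close>
  define n where "n = norm (GL_inv T) + 1"
  have n: "n > 0"
    by (simp add: n_def add_nonneg_pos)
  have "T' \<in> GL" if d: "dist T' T < 1 / (2 * n)" for T'
  proof (rule GL_bounded_below[OF fin])
    show "1 / (2 * n) > 0" using n by simp
    fix x
    have "norm x = norm (GL_inv T (T x))"
      using T by simp
    also have "\<dots> \<le> norm (GL_inv T) * norm (T x)"
      by (rule norm_blinfun)
    also have "\<dots> \<le> n * norm (T x)"
      by (simp add: n_def mult_right_mono)
    finally have "norm x / n \<le> norm (T x)"
      using n by (simp add: field_simps)
    moreover have "norm (T x) \<le> norm (T' x) + norm ((T' - T) x)"
      using norm_triangle_sub[of "T x" "T' x"] by (simp add: blinfun.diff_left norm_minus_commute)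
    moreover have "norm ((T' - T) x) \<le> 1 / (2 * n) * norm x"
      using norm_blinfun[of "T' - T" x] d
      by (smt (verit) dist_norm mult_right_mono norm_ge_zero)
    ultimately show "1 / (2 * n) * norm x \<le> norm (T' x)"
      by (simp add: field_simps)
  qed
  then show "\<exists>e>0. \<forall>T'. dist T' T < e \<longrightarrow> T' \<in> GL"
    using n by (intro exI[of _ "1 / (2 * n)"]) auto
qed

text \<open>The resolvent identity; both continuity and differentiability of inversion rest on
  it.\<close>

lemma GL_inv_diff:
  assumes "S \<in> GL" "T \<in> GL"
  shows "GL_inv S - GL_inv T = - (GL_inv S o\<^sub>L (S - T) o\<^sub>L GL_inv T)"
  using assms by (auto intro!: blinfun_eqI simp: blinfun.bilinear_simps)

lemma continuous_on_GL_inv: "continuous_on GL (GL_inv :: ('v::real_normed_vector \<Rightarrow>\<^sub>L 'v) \<Rightarrow> _)"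
  unfolding continuous_on_def
proof
  fix T :: "'v \<Rightarrow>\<^sub>L 'v"
  assume T: "T \<in> GL"
  define n where "n = norm (GL_inv T) + 1"
  have n: "n > 0" "norm (GL_inv T) \<le> n"
    by (simp_all add: n_def add_nonneg_pos)
  have bound: "norm (GL_inv S - GL_inv T) \<le> 2 * n * norm (S - T) * n"
    if S: "S \<in> GL" "dist S T < 1 / (2 * n)" for S
  proof -
    have le: "norm (GL_inv S - GL_inv T) \<le> norm (GL_inv S) * norm (S - T) * norm (GL_inv T)"
      unfolding GL_inv_diff[OF S(1) T] norm_minus_cancel
      by (meson mult_right_mono norm_blinfun_compose norm_ge_zero order_trans)
    also have "\<dots> \<le> norm (GL_inv S) * (1 / (2 * n)) * n"
      using S(2) n by (intro mult_mono mult_nonneg_nonneg) (auto simp: dist_norm)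
    also have "\<dots> = norm (GL_inv S) / 2"
      using n by simp
    \<comment> \<open>The unknown norm appears on both sides; absorbing half of it on the left
      bounds the inverses uniformly near \<open>T\<close>, after which the resolvent identity gives
      a Lipschitz estimate.\<close>
    finally have "norm (GL_inv S) \<le> norm (GL_inv T) + norm (GL_inv S) / 2"
      by (smt (verit) norm_triangle_sub)
    then have "norm (GL_inv S) \<le> 2 * n"
      using n by simp
    then have "norm (GL_inv S) * norm (S - T) * norm (GL_inv T) \<le> 2 * n * norm (S - T) * n"
      using n by (intro mult_mono) auto
    with le show ?thesis by simp
  qed
  have "((\<lambda>S. norm (GL_inv S - GL_inv T)) \<longlongrightarrow> 0) (at T within GL)"
  proof (rule tendsto_sandwich[OF _ _ tendsto_const])
    show "\<forall>\<^sub>F S in at T within GL. norm (GL_inv S - GL_inv T) \<le> 2 * n * norm (S - T) * n"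
      unfolding eventually_at using bound n(1) by (intro exI[of _ "1 / (2 * n)"]) auto
    have "((\<lambda>S. 2 * n * norm (S - T) * n) \<longlongrightarrow> 2 * n * norm (T - T) * n) (at T within GL)"
      by (intro tendsto_intros)
    then show "((\<lambda>S. 2 * n * norm (S - T) * n) \<longlongrightarrow> 0) (at T within GL)"
      by simp
  qed auto
  then show "(GL_inv \<longlongrightarrow> GL_inv T) (at T within GL)"
    by (rule LIM_zero_cancel[OF tendsto_norm_zero_cancel])
qed

text \<open>By the resolvent identity the remainder is the product of
  \<open>GL_inv S - GL_inv T\<close>, \<open>S - T\<close> and \<open>GL_inv T\<close>, up to sign.
  Divided by \<open>norm (S - T)\<close> it is controlled by the first factor, which vanishes in the
  limit by continuity of inversion.\<close>

lemma has_derivative_GL_inv: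
  fixes T :: "'v::real_normed_vector \<Rightarrow>\<^sub>L 'v"
  assumes T: "T \<in> GL"
  shows "(GL_inv has_derivative (\<lambda>H. - (GL_inv T o\<^sub>L H o\<^sub>L GL_inv T))) (at T within GL)"
proof (rule has_derivativeI_sandwich)
  let ?R = "GL_inv T"
  show "bounded_linear (\<lambda>H. - (?R o\<^sub>L H o\<^sub>L ?R))"
    by (intro bounded_linear_minus
        bounded_linear_compose[OF bounded_bilinear.bounded_linear_left[OF bounded_bilinear_blinfun_compose]
          bounded_bilinear.bounded_linear_right[OF bounded_bilinear_blinfun_compose]])
  show "norm (GL_inv S - ?R - - (?R o\<^sub>L (S - T) o\<^sub>L ?R)) / norm (S - T)
      \<le> norm (GL_inv S - ?R) * norm ?R" if S: "S \<in> GL" "S \<noteq> T" for S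
  proof -
    have "GL_inv S - ?R - - (?R o\<^sub>L (S - T) o\<^sub>L ?R) = - ((GL_inv S - ?R) o\<^sub>L (S - T) o\<^sub>L ?R)"
      unfolding GL_inv_diff[OF S(1) T]
      by (auto intro!: blinfun_eqI simp: blinfun.bilinear_simps T S GL_inv_diff)
    also have "norm \<dots> \<le> norm (GL_inv S - ?R) * norm (S - T) * norm ?R"
      unfolding norm_minus_cancel by (meson mult_right_mono norm_blinfun_compose norm_ge_zero order_trans)
    finally show ?thesis
      using S(2) by (simp add: divide_le_eq mult_ac)
  qed
  have "((\<lambda>S. norm (GL_inv S - ?R) * norm ?R) \<longlongrightarrow> norm (?R - ?R) * norm ?R) (at T within GL)"
    using continuous_on_GL_inv T by (intro tendsto_intros) (auto simp: continuous_on_def)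
  then show "((\<lambda>S. norm (GL_inv S - ?R) * norm ?R) \<longlongrightarrow> 0) (at T within GL)"
    by simp
qed (rule zero_less_one)

lemma smooth_on_GL_inv:
  assumes E: "subspace E" "openin (top_of_set E) S"
    and f: "smooth_on E S f" and fS: "f ` S \<subseteq> GL"
  shows "smooth_on E S (\<lambda>x. GL_inv (f x))"
proof -
  have "Ck_on k E S f \<Longrightarrow> Ck_on k E S (\<lambda>x. GL_inv (f x))" for k
  proof (induction k)
    case 0
    then show ?case
      using continuous_on_compose2[OF continuous_on_GL_inv _ fS] by simp
  next
    case (Suc k)
    obtain D where D: "\<And>x. x \<in> S \<Longrightarrow> (f has_derivative D x) (at x within S)"
        "\<And>v. v \<in> E \<Longrightarrow> Ck_on k E S (\<lambda>x. D x v)"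
      using Ck_on_SucE[OF E Suc.prems] by blast
    \<comment> \<open>Bootstrapping: the derivative of the inverse contains the inverse itself, but
      only at order \<open>k\<close>, where the induction hypothesis supplies it.\<close>
    have inv: "Ck_on k E S (\<lambda>x. GL_inv (f x))"
      using Ck_on_SucD[OF E Suc.prems] by (rule Suc.IH)
    show ?case
    proof (rule Ck_on_SucI[OF E, where D = "\<lambda>x h. - (GL_inv (f x) o\<^sub>L D x h o\<^sub>L GL_inv (f x))"])
      show "((\<lambda>x. GL_inv (f x)) has_derivative (\<lambda>h. - (GL_inv (f x) o\<^sub>L D x h o\<^sub>L GL_inv (f x))))
          (at x within S)" if "x \<in> S" for x
        using that fS
        by (intro has_derivative_in_compose[OF D(1)[OF that]]
            has_derivative_subset[OF has_derivative_GL_inv fS]) auto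
      show "Ck_on k E S (\<lambda>x. - (GL_inv (f x) o\<^sub>L D x v o\<^sub>L GL_inv (f x)))" if "v \<in> E" for v
        by (rule Ck_on_compose_linear[OF E bounded_linear_minus[OF bounded_linear_ident]
              Ck_on_bilinear[OF E bounded_bilinear_blinfun_compose
                Ck_on_bilinear[OF E bounded_bilinear_blinfun_compose inv D(2)[OF that]] inv]])
    qed
  qed
  then show ?thesis
    using f by (simp add: smooth_on_def)
qed

section \<open>Open submanifolds of linear spaces\<close>

lemma inv_into_ident [simp]: "x \<in> S \<Longrightarrow> inv_into S (\<lambda>x. x) x = x"
  using inv_into_f_f[of "\<lambda>x. x" S x] by (simp add: inj_on_def)

text \<open>The product of two identity charts is the identity chart, so maps in two variables, such
  as multiplications and actions, are again handled in a single chart.\<close>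

lemma prod_manifold_open_submanifold:
  "prod_manifold (open_submanifold E S) (open_submanifold F T) = open_submanifold (E \<times> F) (S \<times> T)"
  by (auto simp: prod_manifold_def open_submanifold_def map_prod_def case_prod_beta')

lemma smooth_manifold_open_submanifold:
  fixes E :: "'m::real_normed_vector set"
  assumes "finite_dim (UNIV :: 'm set)" and E: "subspace E" and S: "openin (top_of_set E) S"
  shows "smooth_manifold (open_submanifold E S)"
proof -
  have "smooth_chart (top_of_set S) E (S, \<lambda>x. x)"
    using S by (auto simp: smooth_chart_def subtopology_subtopology homeomorphic_map_id[unfolded id_def])
  moreover have "smooth_on E S ((\<lambda>x. x) \<circ> inv_into S (\<lambda>x. x))"
    using smooth_on_bounded_linear[OF E S bounded_linear_ident]
    by (subst smooth_on_cong[OF E S, of _ "\<lambda>x. x"]) auto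
  moreover have "finite_dim E"
    using finite_dim_subset[OF assms(1) E] by simp
  ultimately show ?thesis
    using second_countable_finite_dim[OF assms(1), of S]
    by (simp add: smooth_manifold_def open_submanifold_def Hausdorff_space_subtopology)
qed

lemma smooth_map_open_submanifold:
  assumes E: "subspace E" "openin (top_of_set E) S" and f: "smooth_on E S f" "f ` S \<subseteq> T"
  shows "smooth_map (open_submanifold E S) (open_submanifold F T) f"
proof -
  have S: "S \<inter> f -` T = S"
    using f(2) by auto
  have "smooth_on E S ((\<lambda>x. x) \<circ> f \<circ> inv_into S (\<lambda>x. x))"
    using f(1) by (subst smooth_on_cong[OF E, of _ f]) auto
  moreover have "continuous_on S f"
    using f(1) by (metis Ck_on.simps(1) smooth_on_def)
  ultimately show ?thesis
    using f(2) by (auto simp: smooth_map_def open_submanifold_def S)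
qed

text \<open>Inverse of \<open>tangent_coord\<close> on tangent vectors; the value 0 at every other
  chart matches the convention in \<open>tangent_space\<close>.\<close>

definition chart_vec :: "'m set \<Rightarrow> 'm::real_normed_vector \<Rightarrow> ('m, 'm) chart \<Rightarrow> 'm" where
  "chart_vec S v = (\<lambda>c. if c = (S, \<lambda>x. x) then v else 0)"

lemma tangent_coord_chart_vec [simp]: "tangent_coord S (chart_vec S v) = v"
  by (simp add: tangent_coord_def chart_vec_def)

lemma chart_vec_apply [simp]: "chart_vec S v (S, \<lambda>x. x) = v"
  by (simp add: chart_vec_def)

lemma chart_vec_ops:
  "chart_vec S 0 = (\<lambda>c. 0)"
  "chart_vec S (v + w) = (\<lambda>c. chart_vec S v c + chart_vec S w c)"
  "chart_vec S (r *\<^sub>R v) = (\<lambda>c. r *\<^sub>R chart_vec S v c)"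
  by (auto simp: chart_vec_def)

lemma dirderiv_chart:
  assumes "subspace E" "openin (top_of_set E) S" "p \<in> S" "v \<in> E"
  shows "dirderiv ((\<lambda>x. x) \<circ> f \<circ> inv_into S (\<lambda>x. x)) p v = dirderiv f p v"
  by (rule dirderiv_cong[OF assms]) simp

lemma tangent_space_open_submanifold:
  assumes E: "subspace E" "openin (top_of_set E) S" and p: "p \<in> S"
  shows "tangent_space (open_submanifold E S) p = chart_vec S ` E"
proof -
  \<comment> \<open>With a single chart, the only transformation rule left to check is the one from
    this chart to itself.\<close>
  have id: "dirderiv ((\<lambda>x. x) \<circ> inv_into S (\<lambda>x. x)) p v = v" if "v \<in> E" for v
  proof -
    have "dirderiv ((\<lambda>x. x) \<circ> inv_into S (\<lambda>x. x)) p v = dirderiv (\<lambda>x. x) p v"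
      by (rule dirderiv_cong[OF E p that]) simp
    also have "\<dots> = v"
      by (rule dirderiv_eqI[OF E p that]) (rule has_derivative_ident)
    finally show ?thesis .
  qed
  show ?thesis
  proof (intro equalityI subsetI)
    fix v assume v: "v \<in> tangent_space (open_submanifold E S) p"
    then have "v = chart_vec S (v (S, \<lambda>x. x))"
      using p by (auto simp: tangent_space_def open_submanifold_def chart_vec_def fun_eq_iff[of v])
    moreover have "v (S, \<lambda>x. x) \<in> E"
      using v p by (auto simp: tangent_space_def open_submanifold_def)
    ultimately show "v \<in> chart_vec S ` E" by blast
  next
    fix v assume "v \<in> chart_vec S ` E"
    then show "v \<in> tangent_space (open_submanifold E S) p"
      using p id by (auto simp: tangent_space_def open_submanifold_def)
        (auto simp: chart_vec_def split: if_splits)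
  qed
qed

lemma chart_at_open_submanifold: "p \<in> S \<Longrightarrow> chart_at (open_submanifold E S) p = (S, \<lambda>x. x)"
  unfolding chart_at_def by (rule some_equality) (auto simp: open_submanifold_def)

lemma tangent_map_open_submanifold:
  assumes "subspace E" "openin (top_of_set E) S" "p \<in> S" "v \<in> E" "f p \<in> T"
  shows "tangent_map (open_submanifold E S) (open_submanifold F T) f p (chart_vec S v)
    = chart_vec T (dirderiv f p v)"
  using assms(5) dirderiv_chart[OF assms(1-4), of f]
  by (auto simp: tangent_map_def fun_eq_iff chart_at_open_submanifold[OF assms(3)] chart_vec_def)
    (auto simp: open_submanifold_def)

section \<open>Transport of structure\<close>

text \<open>Each axiom is an equation between elements of the carrier, so injectivity of
  \<open>f\<close> there moves it to \<open>L'\<close>. Closure of the operations accompanies their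
  compatibility with \<open>f\<close>, because \<open>f\<close> separates points only inside the
  carrier.\<close>

lemma lie_algebra_transport:
  assumes L': "lie_algebra L'" and f: "bij_betw f (lcarrier L) (lcarrier L')"
    and zero: "lzero L \<in> lcarrier L" "f (lzero L) = lzero L'"
    and add: "\<And>x y. x \<in> lcarrier L \<Longrightarrow> y \<in> lcarrier L \<Longrightarrow>
      ladd L x y \<in> lcarrier L \<and> f (ladd L x y) = ladd L' (f x) (f y)"
    and scale: "\<And>r x. x \<in> lcarrier L \<Longrightarrow>
      lscale L r x \<in> lcarrier L \<and> f (lscale L r x) = lscale L' r (f x)"
    and bracket: "\<And>x y. x \<in> lcarrier L \<Longrightarrow> y \<in> lcarrier L \<Longrightarrow>
      lbracket L x y \<in> lcarrier L \<and> f (lbracket L x y) = lbracket L' (f x) (f y)"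
  shows "lie_algebra L" and "lie_algebra_iso L L' f"
proof -
  have eq: "x = y \<longleftrightarrow> f x = f y" if "x \<in> lcarrier L" "y \<in> lcarrier L" for x y
    using f that by (auto simp: bij_betw_def inj_on_def)
  have mem: "f x \<in> lcarrier L'" if "x \<in> lcarrier L" for x
    using f that by (auto simp: bij_betw_def)
  interpret G: comm_group "\<lparr>carrier = lcarrier L', monoid.mult = ladd L', one = lzero L'\<rparr>"
    using L' by (simp add: lie_algebra_def)
  have "comm_group \<lparr>carrier = lcarrier L, monoid.mult = ladd L, one = lzero L\<rparr>"
  proof (rule comm_groupI; simp)
    show "ladd L x y \<in> lcarrier L" if "x \<in> lcarrier L" "y \<in> lcarrier L" for x y
      using add that by blast
    show "lzero L \<in> lcarrier L" by (rule zero)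
    show "ladd L (ladd L x y) z = ladd L x (ladd L y z)"
      if "x \<in> lcarrier L" "y \<in> lcarrier L" "z \<in> lcarrier L" for x y z
      using that G.m_assoc[of "f x" "f y" "f z"] by (simp add: eq add mem)
    show "ladd L x y = ladd L y x" if "x \<in> lcarrier L" "y \<in> lcarrier L" for x y
      using that G.m_comm[of "f x" "f y"] by (simp add: eq add mem)
    show "ladd L (lzero L) x = x" if "x \<in> lcarrier L" for x
      using that G.l_one[of "f x"] by (simp add: eq add mem zero)
    show "\<exists>y\<in>lcarrier L. ladd L y x = lzero L" if x: "x \<in> lcarrier L" for x
    proof -
      obtain y' where y': "y' \<in> lcarrier L'" "ladd L' y' (f x) = lzero L'"
        using G.l_inv_ex[of "f x"] x mem by auto
      then obtain y where "y \<in> lcarrier L" "y' = f y"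
        using f by (auto simp: bij_betw_def)
      then show ?thesis
        using x y' by (intro bexI[of _ y]) (simp_all add: eq add zero)
    qed
  qed
  then show "lie_algebra L"
    using L' unfolding lie_algebra_def by (simp add: eq add scale bracket mem zero)
  show "lie_algebra_iso L L' f"
    using f by (simp add: lie_algebra_iso_def lie_algebra_hom_def lie_linear_def add scale bracket mem)
qed

lemma lie_algebra_closed:
  assumes "lie_algebra L" "x \<in> lcarrier L" "y \<in> lcarrier L"
  shows "ladd L x y \<in> lcarrier L" "lbracket L x y \<in> lcarrier L"
proof -
  interpret comm_group "\<lparr>carrier = lcarrier L, monoid.mult = ladd L, one = lzero L\<rparr>"
    using assms(1) by (simp add: lie_algebra_def)
  show "ladd L x y \<in> lcarrier L"
    using m_closed[of x y] assms by simp
qed (use assms in \<open>auto simp: lie_algebra_def\<close>)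

lemma lie_algebra_lscale_closed: "lie_algebra L \<Longrightarrow> x \<in> lcarrier L \<Longrightarrow> lscale L r x \<in> lcarrier L"
  by (simp add: lie_algebra_def)

text \<open>The same principle as for Lie algebras. That \<open>dt\<close> and \<open>\<phi>\<close>
  stay in the carriers is a separate hypothesis: an isomorphism compares their values only after
  applying \<open>f0\<close> and \<open>f1\<close>, which are injective on the carriers
  alone.\<close>

lemma crossed_module_lie_algebra_transport:
  assumes X: "crossed_module_lie_algebra (L1', L0', dt', \<phi>')"
    and L: "lie_algebra L1" "lie_algebra L0"
    and iso: "crossed_module_lie_algebra_iso (L1, L0, dt, \<phi>) (L1', L0', dt', \<phi>') f1 f0"
    and dt: "\<And>A. A \<in> lcarrier L1 \<Longrightarrow> dt A \<in> lcarrier L0"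
    and \<phi>: "\<And>X A. X \<in> lcarrier L0 \<Longrightarrow> A \<in> lcarrier L1 \<Longrightarrow> \<phi> X A \<in> lcarrier L1"
  shows "crossed_module_lie_algebra (L1, L0, dt, \<phi>)"
proof -
  have iso1: "lie_algebra_iso L1 L1' f1" and iso0: "lie_algebra_iso L0 L0' f0"
    and f_dt: "\<And>A. A \<in> lcarrier L1 \<Longrightarrow> f0 (dt A) = dt' (f1 A)"
    and f_\<phi>: "\<And>X A. X \<in> lcarrier L0 \<Longrightarrow> A \<in> lcarrier L1 \<Longrightarrow> f1 (\<phi> X A) = \<phi>' (f0 X) (f1 A)"
    using iso by (auto simp: crossed_module_lie_algebra_iso_def)
  have eq: "\<And>x y. x \<in> lcarrier L1 \<Longrightarrow> y \<in> lcarrier L1 \<Longrightarrow> x = y \<longleftrightarrow> f1 x = f1 y"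
    "\<And>x y. x \<in> lcarrier L0 \<Longrightarrow> y \<in> lcarrier L0 \<Longrightarrow> x = y \<longleftrightarrow> f0 x = f0 y"
    using iso1 iso0 by (auto simp: lie_algebra_iso_def bij_betw_def inj_on_def)
  have hom: "\<And>x. x \<in> lcarrier L1 \<Longrightarrow> f1 x \<in> lcarrier L1'"
    "\<And>x. x \<in> lcarrier L0 \<Longrightarrow> f0 x \<in> lcarrier L0'"
    "\<And>x y. x \<in> lcarrier L1 \<Longrightarrow> y \<in> lcarrier L1 \<Longrightarrow> f1 (ladd L1 x y) = ladd L1' (f1 x) (f1 y)"
    "\<And>x y. x \<in> lcarrier L0 \<Longrightarrow> y \<in> lcarrier L0 \<Longrightarrow> f0 (ladd L0 x y) = ladd L0' (f0 x) (f0 y)"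
    "\<And>r x. x \<in> lcarrier L1 \<Longrightarrow> f1 (lscale L1 r x) = lscale L1' r (f1 x)"
    "\<And>r x. x \<in> lcarrier L0 \<Longrightarrow> f0 (lscale L0 r x) = lscale L0' r (f0 x)"
    "\<And>x y. x \<in> lcarrier L1 \<Longrightarrow> y \<in> lcarrier L1 \<Longrightarrow> f1 (lbracket L1 x y) = lbracket L1' (f1 x) (f1 y)"
    "\<And>x y. x \<in> lcarrier L0 \<Longrightarrow> y \<in> lcarrier L0 \<Longrightarrow> f0 (lbracket L0 x y) = lbracket L0' (f0 x) (f0 y)"
    using iso1 iso0 by (auto simp: lie_algebra_iso_def lie_algebra_hom_def lie_linear_def)
  note mem = lie_algebra_closed[OF L(1)] lie_algebra_closed[OF L(2)]
    lie_algebra_lscale_closed[OF L(1)] lie_algebra_lscale_closed[OF L(2)]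
  have "lie_algebra_hom L1 L0 dt"
    using X by (simp add: crossed_module_lie_algebra_def lie_algebra_hom_def lie_linear_def
        eq hom mem dt \<phi> f_dt f_\<phi>)
  moreover have "lie_algebra_action L0 L1 \<phi>"
    using X by (simp add: crossed_module_lie_algebra_def lie_algebra_action_def derivation_def
        lie_linear_def eq hom mem dt \<phi> f_dt f_\<phi>)
  moreover have "dt (\<phi> X A) = lbracket L0 X (dt A)" if "X \<in> lcarrier L0" "A \<in> lcarrier L1" for X A
    using X that by (simp add: crossed_module_lie_algebra_def eq hom mem dt \<phi> f_dt f_\<phi>)
  moreover have "\<phi> (dt A) B = lbracket L1 A B" if "A \<in> lcarrier L1" "B \<in> lcarrier L1" for A B
    using X that by (simp add: crossed_module_lie_algebra_def eq hom mem dt \<phi> f_dt f_\<phi>)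
  ultimately show ?thesis
    using L by (simp add: crossed_module_lie_algebra_def)
qed

section \<open>Lie groups on open subsets\<close>

text \<open>The common frame of both groups: \<open>E\<close> is the full operator space for
  \<open>K1 d\<close> and the space of intertwining pairs for \<open>K0 d\<close>.\<close>

locale open_lie_group =
  fixes G :: "('m::real_normed_vector, 'm) lie_grp" (structure) and E S :: "'m set"
  assumes group: "group G"
    and mfd: "mfd G = open_submanifold E S" and carrier: "carrier G = S"
    and fin: "finite_dim (UNIV :: 'm set)"
    and E: "subspace E" and S: "openin (top_of_set E) S"
    and smooth_mult: "smooth_on (E \<times> E) (S \<times> S) (\<lambda>(x, y). x \<otimes> y)"
    and smooth_inv: "smooth_on E S (\<lambda>x. inv x)"
begin

sublocale group G
  by (rule group)

lemma one_mem: "\<one> \<in> S"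
  using carrier one_closed by blast

lemma lie_group: "lie_group G"
proof -
  have "smooth_map (open_submanifold (E \<times> E) (S \<times> S)) (open_submanifold E S) (\<lambda>(x, y). x \<otimes> y)"
    using m_closed carrier
    by (intro smooth_map_open_submanifold subspace_Times E smooth_mult openin_Times S) auto
  moreover have "smooth_map (open_submanifold E S) (open_submanifold E S) (\<lambda>x. inv x)"
    using inv_closed carrier by (intro smooth_map_open_submanifold E S smooth_inv) auto
  ultimately show ?thesis
    using smooth_manifold_open_submanifold[OF fin E S] group
    by (simp add: lie_group_def mfd prod_manifold_open_submanifold carrier)
      (simp add: open_submanifold_def)
qed

lemma lie_algebra_of_simps:
  "lcarrier (lie_algebra_of G) = chart_vec S ` E"
  "lzero (lie_algebra_of G) = (\<lambda>c. 0)"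
  "ladd (lie_algebra_of G) v w = (\<lambda>c. v c + w c)"
  "lscale (lie_algebra_of G) r v = (\<lambda>c. r *\<^sub>R v c)"
  using tangent_space_open_submanifold[OF E S one_mem]
  by (simp_all add: lie_algebra_of_def mfd)

lemma left_invariant_field_eq:
  assumes "x \<in> S" "v \<in> E"
  shows "left_invariant_field G (chart_vec S v) x = chart_vec S (dirderiv (\<lambda>y. x \<otimes> y) \<one> v)"
  using assms carrier unfolding left_invariant_field_def mfd
  by (intro tangent_map_open_submanifold E S one_mem) auto

lemma bracket_eq:
  assumes v: "v \<in> E" and w: "w \<in> E"
  shows "lbracket (lie_algebra_of G) (chart_vec S v) (chart_vec S w) = chart_vec S
    (dirderiv (\<lambda>x. dirderiv (\<lambda>y. x \<otimes> y) \<one> w) \<one> v - dirderiv (\<lambda>x. dirderiv (\<lambda>y. x \<otimes> y) \<one> v) \<one> w)"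
proof -
  \<comment> \<open>At the identity a left-invariant field returns the vector that generates it, so
    the outer derivatives of the bracket are taken in the directions \<open>v\<close> and
    \<open>w\<close> themselves.\<close>
  have id: "dirderiv (\<lambda>y. \<one> \<otimes> y) \<one> v = v" if "v \<in> E" for v
  proof -
    have "dirderiv (\<lambda>y. \<one> \<otimes> y) \<one> v = dirderiv (\<lambda>y. y) \<one> v"
      using carrier by (intro dirderiv_cong[OF E S one_mem that]) auto
    also have "\<dots> = v"
      by (rule dirderiv_eqI[OF E S one_mem that]) (rule has_derivative_ident)
    finally show ?thesis .
  qed
  have field: "dirderiv (\<lambda>x. left_invariant_field G (chart_vec S a) (inv_into S (\<lambda>x. x) x) (S, \<lambda>x. x))
      \<one> b = dirderiv (\<lambda>x. dirderiv (\<lambda>y. x \<otimes> y) \<one> a) \<one> b" if "a \<in> E" "b \<in> E" for a b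
    using that by (intro dirderiv_cong[OF E S one_mem])
      (simp_all add: left_invariant_field_eq)
  have val: "left_invariant_field G (chart_vec S a) \<one> (S, \<lambda>x. x) = a" if "a \<in> E" for a
    using that by (simp add: left_invariant_field_eq one_mem id)
  show ?thesis
    using one_mem v w
    by (auto simp: lie_algebra_of_def vector_field_bracket_def mfd fun_eq_iff chart_vec_def[of S "_ - _"]
        field val)
      (auto simp: open_submanifold_def field val)
qed

text \<open>The Jacobi identity is not derived from vector fields: it is pulled back from a concrete
  \<open>L\<close> whose bracket agrees with the mixed second derivatives.\<close>

lemma lie_algebra_of_iso:
  assumes L: "lie_algebra L" "lcarrier L = E" "lzero L = 0" "ladd L = (+)" "lscale L = (*\<^sub>R)"
    and bracket: "\<And>v w. v \<in> E \<Longrightarrow> w \<in> E \<Longrightarrow> lbracket L v w =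
      dirderiv (\<lambda>x. dirderiv (\<lambda>y. x \<otimes> y) \<one> w) \<one> v - dirderiv (\<lambda>x. dirderiv (\<lambda>y. x \<otimes> y) \<one> v) \<one> w"
  shows "lie_algebra (lie_algebra_of G)" "lie_algebra_iso (lie_algebra_of G) L (tangent_coord S)"
proof -
  have cl: "0 \<in> E" "\<And>v w. v \<in> E \<Longrightarrow> w \<in> E \<Longrightarrow> v + w \<in> E" "\<And>r v. v \<in> E \<Longrightarrow> r *\<^sub>R v \<in> E"
    "\<And>v w. v \<in> E \<Longrightarrow> w \<in> E \<Longrightarrow> lbracket L v w \<in> E"
    using E L by (auto simp: subspace_def lie_algebra_def)
  have "bij_betw (tangent_coord S) (lcarrier (lie_algebra_of G)) (lcarrier L)"
    by (rule bij_betw_byWitness[where f' = "chart_vec S"]) (auto simp: lie_algebra_of_simps L(2))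
  note t = lie_algebra_transport[OF L(1) this]
  have br: "lbracket (lie_algebra_of G) (chart_vec S v) (chart_vec S w) = chart_vec S (lbracket L v w)"
    if "v \<in> E" "w \<in> E" for v w
    using that by (simp add: bracket bracket_eq)
  have zero: "(\<lambda>c. 0) = chart_vec S 0"
    by (simp add: chart_vec_ops)
  show "lie_algebra (lie_algebra_of G)" "lie_algebra_iso (lie_algebra_of G) L (tangent_coord S)"
    by (rule t; auto simp: lie_algebra_of_simps L br cl zero simp flip: chart_vec_ops(2,3))+
qed

end

lemma diff_hom_open_lie_group:
  assumes "open_lie_group G E S" "open_lie_group H F T" "t \<one>\<^bsub>G\<^esub> \<in> T" "v \<in> E"
  shows "diff_hom G H t (chart_vec S v) = chart_vec T (dirderiv t \<one>\<^bsub>G\<^esub> v)"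
proof -
  interpret G: open_lie_group G E S by fact
  interpret H: open_lie_group H F T by fact
  show ?thesis
    unfolding diff_hom_def G.mfd H.mfd
    by (rule tangent_map_open_submanifold[OF G.E G.S G.one_mem assms(4)]) (rule assms(3))
qed

lemma diff_action_open_lie_group:
  assumes "open_lie_group G E S" "open_lie_group H F T"
    and \<Phi>: "\<And>g. g \<in> S \<Longrightarrow> \<Phi> g \<one>\<^bsub>H\<^esub> \<in> T" and X: "X \<in> E" and A: "A \<in> F"
  shows "diff_action G H \<Phi> (chart_vec S X) (chart_vec T A)
    = chart_vec T (dirderiv (\<lambda>g. dirderiv (\<Phi> g) \<one>\<^bsub>H\<^esub> A) \<one>\<^bsub>G\<^esub> X)"
proof -
  interpret G: open_lie_group G E S by fact
  interpret H: open_lie_group H F T by fact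
  have "dirderiv (\<lambda>g. diff_hom H H (\<Phi> (inv_into S (\<lambda>x. x) g)) (chart_vec T A) c) \<one>\<^bsub>G\<^esub> X
      = dirderiv (\<lambda>g. chart_vec T (dirderiv (\<Phi> g) \<one>\<^bsub>H\<^esub> A) c) \<one>\<^bsub>G\<^esub> X" for c
    using assms
    by (intro dirderiv_cong[OF G.E G.S G.one_mem X]) (simp add: diff_hom_open_lie_group[where E = F])
  \<comment> \<open>Serves the components at charts other than the one of \<open>H\<close>, where
    the differentiated function is constantly zero.\<close>
  moreover have "dirderiv (\<lambda>g. 0 :: 'b) \<one>\<^bsub>G\<^esub> X = 0"
    by (rule dirderiv_eqI[OF G.E G.S G.one_mem X]) (rule has_derivative_const)
  ultimately show ?thesis
    by (intro ext, simp add: diff_action_def G.mfd chart_at_open_submanifold[OF G.one_mem])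
      (simp add: chart_vec_def)
qed

section \<open>The crossed modules of a complex\<close>

lemma blinfun_eq_iff: "f = g \<longleftrightarrow> (\<forall>x. blinfun_apply f x = blinfun_apply g x)"
  using blinfun_eqI by auto

lemmas blinfun_alg = prod_eq_iff blinfun_eq_iff blinfun.bilinear_simps

text \<open>Used twice: with \<open>f\<close> an element of \<open>K1_set d\<close> it reconciles
  the two formulas for its inverse, and with \<open>f\<close> the differential \<open>d\<close> it
  shows that \<open>K0_set d\<close> is closed under inversion.\<close>

lemma GL_inv_intertwine:
  assumes "P \<in> GL" "Q \<in> GL" "f o\<^sub>L P = Q o\<^sub>L f"
  shows "f o\<^sub>L GL_inv P = GL_inv Q o\<^sub>L f"
proof (rule blinfun_eqI)
  fix x
  have "Q (f (GL_inv P x)) = f x"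
    using assms(1) assms(3)[symmetric, THEN arg_cong, of "\<lambda>T. blinfun_apply T (GL_inv P x)"] by simp
  then show "(f o\<^sub>L GL_inv P) x = (GL_inv Q o\<^sub>L f) x"
    using GL_inv_apply(1)[OF assms(2), of "f (GL_inv P x)"] by simp
qed

text \<open>An inverse \<open>S\<close> of the block matrix is not known in advance to be diagonal,
  but its two diagonal blocks already invert \<open>A\<close> and \<open>B\<close>.\<close>

lemma block_diag_in_GL: "block_diag (A, B) \<in> GL \<longleftrightarrow> A \<in> GL \<and> B \<in> GL"
proof
  assume "block_diag (A, B) \<in> GL"
  then obtain S where S: "S o\<^sub>L block_diag (A, B) = id_blinfun" "block_diag (A, B) o\<^sub>L S = id_blinfun"
    by (auto simp: GL_def)
  have 1: "S (A x, B y) = (x, y)" for x y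
    using S(1)[THEN arg_cong, of "\<lambda>T. blinfun_apply T (x, y)"] by (simp add: block_diag.rep_eq)
  have 2: "A (fst (S p)) = fst p \<and> B (snd (S p)) = snd p" for p
    using S(2)[THEN arg_cong, of "\<lambda>T. blinfun_apply T p"]
    by (simp add: block_diag.rep_eq case_prod_beta' prod_eq_iff)
  have bl: "bounded_linear (\<lambda>x. fst (S (x, 0)))" "bounded_linear (\<lambda>y. snd (S (0, y)))"
    by (intro bounded_linear_compose[OF bounded_linear_fst]
        bounded_linear_compose[OF bounded_linear_snd]
        bounded_linear_compose[OF blinfun.bounded_linear_right]
        bounded_linear_Pair bounded_linear_ident bounded_linear_zero)+
  have "A \<in> GL"
    by (rule GL_inv_unique(1)[of "Blinfun (\<lambda>x. fst (S (x, 0)))"])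
      (use 1[of _ 0] 2 in \<open>auto intro!: blinfun_eqI simp: bounded_linear_Blinfun_apply[OF bl(1)] blinfun.zero_right\<close>)
  moreover have "B \<in> GL"
    by (rule GL_inv_unique(1)[of "Blinfun (\<lambda>y. snd (S (0, y)))"])
      (use 1[of 0] 2 in \<open>auto intro!: blinfun_eqI simp: bounded_linear_Blinfun_apply[OF bl(2)] blinfun.zero_right\<close>)
  ultimately show "A \<in> GL \<and> B \<in> GL" by blast
next
  assume "A \<in> GL \<and> B \<in> GL"
  then show "block_diag (A, B) \<in> GL"
    by (intro GL_inv_unique(1)[of "block_diag (GL_inv A, GL_inv B)"])
      (auto intro!: blinfun_eqI simp: block_diag.rep_eq)
qed

text \<open>For maps given by one formula on the whole ambient space; an unrestricted derivative
  then serves even at points of \<open>K0_set d\<close>.\<close>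

lemma dirderiv_at:
  assumes "(f has_derivative D) (at x)"
  shows "dirderiv f x v = D v"
  by (rule dirderiv_eqI[of UNIV UNIV]) (use assms in auto)

section \<open>The groups K1 and K0\<close>

lemma K1_set_iff: "M \<in> K1_set d \<longleftrightarrow> id_blinfun + (d o\<^sub>L M) \<in> GL \<and> (M o\<^sub>L d) + id_blinfun \<in> GL"
  by (simp add: K1_set_def int_delta_def block_diag_in_GL)

lemma mem_k0_iff: "X \<in> lcarrier (k0 d) \<longleftrightarrow> (\<forall>x. fst X (d x) = d (snd X x))"
  by (simp add: k0_def case_prod_beta' blinfun_eq_iff)

lemma K0_set_eq: "K0_set d = lcarrier (k0 d) \<inter> GL \<times> GL"
  by (auto simp: K0_set_def k0_def)

lemma subspace_k0: "subspace (lcarrier (k0 d))"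
  by (auto simp: subspace_def mem_k0_iff blinfun.bilinear_simps)

lemma int_delta_mult:
  "int_delta d (M1 + M2 + (M1 o\<^sub>L d o\<^sub>L M2)) =
    (fst (int_delta d M1) o\<^sub>L fst (int_delta d M2), snd (int_delta d M1) o\<^sub>L snd (int_delta d M2))"
  by (simp add: int_delta_def blinfun_alg algebra_simps)

lemma K1_inverse:
  assumes M: "M \<in> K1_set d"
  defines "N \<equiv> - (GL_inv (id_blinfun + (M o\<^sub>L d)) o\<^sub>L M)"
  shows "N = - (M o\<^sub>L GL_inv (id_blinfun + (d o\<^sub>L M)))"
    and "N \<in> K1_set d" and "N + M + (N o\<^sub>L d o\<^sub>L M) = 0"
proof -
  let ?P = "id_blinfun + (d o\<^sub>L M)" and ?Q = "id_blinfun + (M o\<^sub>L d)"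
  have PQ: "?P \<in> GL" "?Q \<in> GL"
    using M by (simp_all add: K1_set_iff add.commute)
  have "M o\<^sub>L ?P = ?Q o\<^sub>L M"
    by (simp add: blinfun_alg)
  from GL_inv_intertwine[OF PQ this]
  show N: "N = - (M o\<^sub>L GL_inv ?P)"
    by (simp add: N_def)
  \<comment> \<open>Writing P and Q for \<open>?P\<close> and \<open>?Q\<close>, expanding P P^-1 =
    I and Q^-1 Q = I gives d M P^-1 = I - P^-1 and Q^-1 M d = I - Q^-1. The remaining claims reduce
    to these two.\<close>
  have "GL_inv ?P (?P x) = x" "?P (GL_inv ?P x) = x" for x
    using PQ by (simp_all del: blinfun_apply_blinfun_compose)
  then have P: "d (M (GL_inv ?P x)) = x - GL_inv ?P x" for x
    by (simp add: blinfun.bilinear_simps algebra_simps)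
  have "GL_inv ?Q (?Q x) = x" for x
    by (rule GL_inv_apply(1)[OF PQ(2)])
  then have Q: "GL_inv ?Q (M (d x)) = x - GL_inv ?Q x" for x
    by (simp add: blinfun.bilinear_simps algebra_simps)
  \<comment> \<open>The blocks of \<open>int_delta d N\<close> are the inverses of those of
    \<open>int_delta d M\<close>, as multiplicativity of \<open>int_delta\<close> demands.\<close>
  have "id_blinfun + (d o\<^sub>L N) = GL_inv ?P"
    by (simp add: N blinfun_alg P)
  moreover have "(N o\<^sub>L d) + id_blinfun = GL_inv ?Q"
    by (simp add: N_def blinfun_alg Q)
  ultimately show "N \<in> K1_set d"
    using PQ by (simp add: K1_set_iff GL_GL_inv)
  show "N + M + (N o\<^sub>L d o\<^sub>L M) = 0"
    by (simp add: N_def blinfun_alg Q)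
qed

lemma group_K1: "group (K1 d)"
proof (rule groupI)
  show "x \<otimes>\<^bsub>K1 d\<^esub> y \<in> carrier (K1 d)" if "x \<in> carrier (K1 d)" "y \<in> carrier (K1 d)" for x y
    using that int_delta_mult[of d x y]
    by (simp add: K1_def K1_set_def int_delta_def block_diag_in_GL GL_compose)
  show "\<one>\<^bsub>K1 d\<^esub> \<in> carrier (K1 d)"
    by (simp add: K1_def K1_set_iff GL_id)
  show "\<exists>y\<in>carrier (K1 d). y \<otimes>\<^bsub>K1 d\<^esub> x = \<one>\<^bsub>K1 d\<^esub>" if "x \<in> carrier (K1 d)" for x
    using that K1_inverse(2,3)[of x d]
    by (intro bexI[of _ "- (GL_inv (id_blinfun + (x o\<^sub>L d)) o\<^sub>L x)"]) (auto simp: K1_def)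
qed (simp_all add: K1_def blinfun_alg algebra_simps)

lemma K1_inv:
  assumes "M \<in> K1_set d"
  shows "inv\<^bsub>K1 d\<^esub> M = - (GL_inv (id_blinfun + (M o\<^sub>L d)) o\<^sub>L M)"
  using assms K1_inverse(2,3)[OF assms]
  by (intro group.inv_equality[OF group_K1]) (simp_all add: K1_def)

lemma GL_inv_k0:
  assumes "X \<in> K0_set d"
  shows "GL_inv (fst X) (d x) = d (GL_inv (snd X) x)"
proof -
  have "snd X \<in> GL" "fst X \<in> GL" "d o\<^sub>L snd X = fst X o\<^sub>L d"
    using assms by (auto simp: K0_set_def)
  from GL_inv_intertwine[OF this, THEN arg_cong, of "\<lambda>T. blinfun_apply T x"]
  show ?thesis by simp
qed

lemma K0_set_iff: "X \<in> K0_set d \<longleftrightarrow> fst X \<in> GL \<and> snd X \<in> GL \<and> (\<forall>x. fst X (d x) = d (snd X x))"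
  by (auto simp: K0_set_def blinfun_eq_iff)

lemma K0_simps:
  "carrier (K0 d) = K0_set d" "\<one>\<^bsub>K0 d\<^esub> = (id_blinfun, id_blinfun)"
  "x \<otimes>\<^bsub>K0 d\<^esub> y = (fst x o\<^sub>L fst y, snd x o\<^sub>L snd y)"
  "mfd (K0 d) = open_submanifold (lcarrier (k0 d)) (K0_set d)"
  by (simp_all add: K0_def case_prod_beta')

lemma K1_simps:
  "carrier (K1 d) = K1_set d" "\<one>\<^bsub>K1 d\<^esub> = 0"
  "M1 \<otimes>\<^bsub>K1 d\<^esub> M2 = M1 + M2 + (M1 o\<^sub>L d o\<^sub>L M2)"
  "mfd (K1 d) = open_submanifold UNIV (K1_set d)"
  by (simp_all add: K1_def)

lemma K0_inverse_mem: "X \<in> K0_set d \<Longrightarrow> (GL_inv (fst X), GL_inv (snd X)) \<in> K0_set d"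
  using GL_inv_k0[of X d] by (auto simp: K0_set_iff GL_GL_inv)

lemma group_K0: "group (K0 d)"
proof (rule groupI)
  show "\<exists>y\<in>carrier (K0 d). y \<otimes>\<^bsub>K0 d\<^esub> x = \<one>\<^bsub>K0 d\<^esub>" if "x \<in> carrier (K0 d)" for x
    using that K0_inverse_mem[of x d] GL_inv_props(1)[of "fst x"] GL_inv_props(1)[of "snd x"]
    by (intro bexI[of _ "(GL_inv (fst x), GL_inv (snd x))"]) (auto simp: K0_simps K0_set_iff)
qed (auto simp: K0_simps K0_set_iff GL_id GL_compose blinfun_compose_monoid)

lemma K0_inv:
  assumes "X \<in> K0_set d"
  shows "inv\<^bsub>K0 d\<^esub> X = (GL_inv (fst X), GL_inv (snd X))"
  using assms K0_inverse_mem[OF assms]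
  by (intro group.inv_equality[OF group_K0]) (auto simp: K0_simps K0_set_iff GL_inv_props)

section \<open>The crossed module of Lie algebras End(V)\<close>

text \<open>The bracket identities are demanded on the whole type, where they are pure operator
  algebra; only closure of the bracket refers to \<open>E\<close>.\<close>

lemma lie_algebra_subspaceI:
  fixes L :: "'v::real_vector lie_alg"
  assumes L: "lcarrier L = E" "lzero L = 0" "ladd L = (+)" "lscale L = (*\<^sub>R)"
    and E: "subspace E"
    and "\<And>x y. x \<in> E \<Longrightarrow> y \<in> E \<Longrightarrow> lbracket L x y \<in> E"
    and "\<And>x y z. lbracket L (x + y) z = lbracket L x z + lbracket L y z"
    and "\<And>x y z. lbracket L z (x + y) = lbracket L z x + lbracket L z y"
    and "\<And>r x y. lbracket L (r *\<^sub>R x) y = r *\<^sub>R lbracket L x y"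
    and "\<And>r x y. lbracket L x (r *\<^sub>R y) = r *\<^sub>R lbracket L x y"
    and "\<And>x. lbracket L x x = 0"
    and "\<And>x y z. lbracket L x (lbracket L y z) + (lbracket L y (lbracket L z x)
      + lbracket L z (lbracket L x y)) = 0"
  shows "lie_algebra L"
proof -
  have "comm_group \<lparr>carrier = E, monoid.mult = (+), one = 0\<rparr>"
  proof (rule comm_groupI; simp)
    show "\<exists>y\<in>E. y + x = 0" if "x \<in> E" for x
      using subspace_neg[OF E that] by (intro bexI[of _ "- x"]) auto
  qed (use E in \<open>auto simp: subspace_def algebra_simps\<close>)
  then show ?thesis
    using assms by (simp add: lie_algebra_def subspace_scale algebra_simps)
qed

lemma lie_algebra_k1: "lie_algebra (k1 d)"
  by (rule lie_algebra_subspaceI[where E = UNIV])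
    (simp_all add: k1_def blinfun_alg algebra_simps)

lemma lie_algebra_k0: "lie_algebra (k0 d)"
proof (rule lie_algebra_subspaceI[OF refl _ _ _ subspace_k0])
  show "lbracket (k0 d) x y \<in> lcarrier (k0 d)" if "x \<in> lcarrier (k0 d)" "y \<in> lcarrier (k0 d)" for x y
    using that by (simp add: mem_k0_iff) (simp add: k0_def case_prod_beta' blinfun.bilinear_simps)
qed (simp_all add: k0_def case_prod_beta' blinfun_alg algebra_simps)

text \<open>All axioms are identities between noncommuting operators. The relation X0 d = d X1
  enters in the derivation property of \<open>phi\<close> and in the equivariance of
  \<open>delta\<close>, where d meets a block from either side.\<close>

lemma crossed_module_End: "crossed_module_lie_algebra (End_xmod d)"
proof -
  have "lie_algebra_hom (k1 d) (k0 d) (delta d)"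
    by (simp add: lie_algebra_hom_def lie_linear_def mem_k0_iff)
      (simp add: k1_def k0_def delta_def blinfun_alg algebra_simps)
  moreover have "lie_algebra_action (k0 d) (k1 d) phi"
    unfolding lie_algebra_action_def derivation_def lie_linear_def mem_k0_iff Ball_def
    by (simp add: k1_def k0_def phi_def case_prod_beta' blinfun_alg algebra_simps)
  moreover have "delta d (phi X A) = lbracket (k0 d) X (delta d A)" if "X \<in> lcarrier (k0 d)" for X A
    using that unfolding mem_k0_iff
    by (simp add: k0_def phi_def delta_def case_prod_beta' blinfun_alg algebra_simps)
  moreover have "phi (delta d A) B = lbracket (k1 d) A B" for A B
    by (simp add: k1_def phi_def delta_def blinfun_alg algebra_simps)
  ultimately show ?thesis
    by (simp add: crossed_module_lie_algebra_def End_xmod_def lie_algebra_k0 lie_algebra_k1)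
qed

section \<open>The action of K0 on K1\<close>

lemma Phi_eq: "Phi g M = snd g o\<^sub>L M o\<^sub>L GL_inv (fst g)"
  by (simp add: Phi_def case_prod_beta')

text \<open>Since d B1 = B0 d, the factor d moves through the action and turns it into conjugation.
  This shows both that \<open>Phi\<close> preserves \<open>K1_set d\<close> and that
  \<open>int_delta\<close> is equivariant.\<close>

lemma int_delta_Phi:
  assumes g: "g \<in> K0_set d"
  shows "int_delta d (Phi g M) = (fst g o\<^sub>L fst (int_delta d M) o\<^sub>L GL_inv (fst g),
    snd g o\<^sub>L snd (int_delta d M) o\<^sub>L GL_inv (snd g))"
  using g GL_inv_k0[OF g]
  by (simp add: int_delta_def Phi_eq blinfun_alg K0_set_iff)

lemma Phi_mem: "g \<in> K0_set d \<Longrightarrow> M \<in> K1_set d \<Longrightarrow> Phi g M \<in> K1_set d"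
  using int_delta_Phi[of g d M]
  by (simp add: K1_set_def block_diag_in_GL K0_set_iff GL_compose GL_GL_inv)
    (simp add: int_delta_def block_diag_in_GL GL_compose GL_GL_inv)

lemma Phi_iso:
  assumes g: "g \<in> K0_set d"
  shows "Phi g \<in> iso (K1 d) (K1 d)"
proof -
  \<comment> \<open>In the quadratic term of the multiplication the inner factor B0^-1 d B1
    collapses to d.\<close>
  have "Phi g \<in> hom (K1 d) (K1 d)"
    using Phi_mem[OF g] g by (auto simp: hom_def K1_simps Phi_eq blinfun_alg K0_set_iff
        GL_inv_k0[OF g])
  moreover have "bij_betw (Phi g) (K1_set d) (K1_set d)"
    using Phi_mem[OF g] Phi_mem[OF K0_inverse_mem[OF g]] g
    by (intro bij_betw_byWitness[where f' = "Phi (GL_inv (fst g), GL_inv (snd g))"])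
      (auto simp: Phi_eq blinfun_eq_iff K0_set_iff GL_GL_inv)
  ultimately show ?thesis
    by (simp add: iso_def K1_simps)
qed

lemma int_delta_mem: "M \<in> K1_set d \<Longrightarrow> int_delta d M \<in> K0_set d"
  by (simp add: K1_set_iff K0_set_iff int_delta_def blinfun.bilinear_simps)

section \<open>Lie group structures on K1 and K0\<close>

lemma open_K1_set:
  fixes d :: "'b::real_normed_vector \<Rightarrow>\<^sub>L 'a::real_normed_vector"
  assumes "finite_dim (UNIV :: 'a set)" "finite_dim (UNIV :: 'b set)"
  shows "open (K1_set d)"
proof -
  have "K1_set d = (\<lambda>M. id_blinfun + (d o\<^sub>L M)) -` GL \<inter> (\<lambda>M. (M o\<^sub>L d) + id_blinfun) -` GL"
    by (auto simp: K1_set_iff)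
  also have "open \<dots>"
    by (intro open_Int open_vimage open_GL assms continuous_intros)
  finally show ?thesis .
qed

lemma openin_K0_set:
  fixes d :: "'b::real_normed_vector \<Rightarrow>\<^sub>L 'a::real_normed_vector"
  assumes "finite_dim (UNIV :: 'a set)" "finite_dim (UNIV :: 'b set)"
  shows "openin (top_of_set (lcarrier (k0 d))) (K0_set d)"
  unfolding K0_set_eq by (intro openin_open_Int open_Times open_GL assms)

lemma open_lie_group_K1:
  fixes d :: "'b::real_normed_vector \<Rightarrow>\<^sub>L 'a::real_normed_vector"
  assumes fin: "finite_dim (UNIV :: 'a set)" "finite_dim (UNIV :: 'b set)"
  shows "open_lie_group (K1 d) UNIV (K1_set d)"
proof (rule open_lie_group.intro)
  show "finite_dim (UNIV :: ('a \<Rightarrow>\<^sub>L 'b) set)"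
    by (rule finite_dim_blinfun[OF fin])
  show S: "openin (top_of_set UNIV) (K1_set d)"
    using open_K1_set[OF fin] by simp
  have U: "subspace (UNIV :: ('a \<Rightarrow>\<^sub>L 'b) set)"
    by simp
  note E2 = subspace_Times[OF U U] openin_Times[OF S S]
  have fst: "smooth_on (UNIV \<times> UNIV) (K1_set d \<times> K1_set d) fst"
    and snd: "smooth_on (UNIV \<times> UNIV) (K1_set d \<times> K1_set d) snd"
    by (rule smooth_on_bounded_linear[OF E2 bounded_linear_fst]
        smooth_on_bounded_linear[OF E2 bounded_linear_snd])+
  show "smooth_on (UNIV \<times> UNIV) (K1_set d \<times> K1_set d) (\<lambda>(x, y). x \<otimes>\<^bsub>K1 d\<^esub> y)"
    unfolding K1_simps case_prod_beta'
    by (rule smooth_on_add[OF E2 smooth_on_add[OF E2 fst snd] smooth_on_blinfun_compose[OF E2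
            smooth_on_blinfun_compose[OF E2 fst smooth_on_const[OF E2]] snd]])
  have id: "smooth_on UNIV (K1_set d) (\<lambda>M. M)"
    by (rule smooth_on_bounded_linear[OF U S bounded_linear_ident])
  have Q: "smooth_on UNIV (K1_set d) (\<lambda>M. id_blinfun + (M o\<^sub>L d))"
    by (rule smooth_on_add[OF U S smooth_on_const[OF U S]
          smooth_on_blinfun_compose[OF U S id smooth_on_const[OF U S]]])
  have "smooth_on UNIV (K1_set d) (\<lambda>M. - (GL_inv (id_blinfun + (M o\<^sub>L d)) o\<^sub>L M))"
    by (rule smooth_on_uminus[OF U S smooth_on_blinfun_compose[OF U S smooth_on_GL_inv[OF U S Q] id]])
      (auto simp: K1_set_iff add.commute)
  then show "smooth_on UNIV (K1_set d) (\<lambda>M. inv\<^bsub>K1 d\<^esub> M)"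
    by (subst smooth_on_cong[OF U S K1_inv])
qed (simp_all add: group_K1 K1_simps)

lemma open_lie_group_K0:
  fixes d :: "'b::real_normed_vector \<Rightarrow>\<^sub>L 'a::real_normed_vector"
  assumes fin: "finite_dim (UNIV :: 'a set)" "finite_dim (UNIV :: 'b set)"
  shows "open_lie_group (K0 d) (lcarrier (k0 d)) (K0_set d)"
proof (rule open_lie_group.intro)
  let ?E = "lcarrier (k0 d)" and ?S = "K0_set d"
  show "finite_dim (UNIV :: (('a \<Rightarrow>\<^sub>L 'a) \<times> ('b \<Rightarrow>\<^sub>L 'b)) set)"
    by (intro finite_dim_prod finite_dim_blinfun fin)
  note E = subspace_k0[of d] openin_K0_set[OF fin, of d]
  note E2 = subspace_Times[OF E(1) E(1)] openin_Times[OF E(2) E(2)]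
  have proj: "smooth_on (?E \<times> ?E) (?S \<times> ?S) (\<lambda>p. fst (fst p))"
      "smooth_on (?E \<times> ?E) (?S \<times> ?S) (\<lambda>p. snd (fst p))"
      "smooth_on (?E \<times> ?E) (?S \<times> ?S) (\<lambda>p. fst (snd p))"
      "smooth_on (?E \<times> ?E) (?S \<times> ?S) (\<lambda>p. snd (snd p))"
    by (intro smooth_on_bounded_linear[OF E2] bounded_linear_intros)+
  show "smooth_on (?E \<times> ?E) (?S \<times> ?S) (\<lambda>(x, y). x \<otimes>\<^bsub>K0 d\<^esub> y)"
    unfolding K0_simps case_prod_beta'
    by (rule smooth_on_Pair[OF E2 smooth_on_blinfun_compose[OF E2 proj(1,3)]
          smooth_on_blinfun_compose[OF E2 proj(2,4)]])
  have "smooth_on ?E ?S (\<lambda>X. (GL_inv (fst X), GL_inv (snd X)))"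
    by (intro smooth_on_Pair[OF E] smooth_on_GL_inv[OF E]
        smooth_on_bounded_linear[OF E bounded_linear_fst]
        smooth_on_bounded_linear[OF E bounded_linear_snd]) (auto simp: K0_set_iff)
  then show "smooth_on ?E ?S (\<lambda>X. inv\<^bsub>K0 d\<^esub> X)"
    by (subst smooth_on_cong[OF E K0_inv])
qed (simp_all add: group_K0 K0_simps subspace_k0 openin_K0_set fin)

section \<open>Lie algebras of the groups and differentials of the structure maps\<close>

text \<open>The summands of the multiplication that depend on one factor only drop out of the mixed
  derivative; M1 d M2 leaves v d w, whose antisymmetrization is the bracket of
  \<open>k1 d\<close>.\<close>

lemma lie_algebra_of_K1:
  fixes d :: "'b::real_normed_vector \<Rightarrow>\<^sub>L 'a::real_normed_vector"
  assumes fin: "finite_dim (UNIV :: 'a set)" "finite_dim (UNIV :: 'b set)"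
  shows "lie_algebra (lie_algebra_of (K1 d))"
    and "lie_algebra_iso (lie_algebra_of (K1 d)) (k1 d) (tangent_coord (K1_set d))"
proof -
  have inner: "dirderiv (\<lambda>y. x \<otimes>\<^bsub>K1 d\<^esub> y) \<one>\<^bsub>K1 d\<^esub> v = v + (x o\<^sub>L d o\<^sub>L v)" for x v
    unfolding K1_simps
    by (rule dirderiv_at[where D = "\<lambda>h. h + (x o\<^sub>L d o\<^sub>L h)"]) (auto intro!: derivative_eq_intros)
  have outer: "dirderiv (\<lambda>x. w + (x o\<^sub>L d o\<^sub>L w)) \<one>\<^bsub>K1 d\<^esub> v = v o\<^sub>L d o\<^sub>L w" for v w
    by (rule dirderiv_at[where D = "\<lambda>h. h o\<^sub>L d o\<^sub>L w"]) (auto intro!: derivative_eq_intros)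
  note t = open_lie_group.lie_algebra_of_iso[OF open_lie_group_K1[OF fin] lie_algebra_k1]
  show "lie_algebra (lie_algebra_of (K1 d))"
    by (rule t(1); simp add: k1_def inner outer case_prod_beta')
  show "lie_algebra_iso (lie_algebra_of (K1 d)) (k1 d) (tangent_coord (K1_set d))"
    by (rule t(2); simp add: k1_def inner outer case_prod_beta')
qed

text \<open>The multiplication is bilinear, so its mixed derivative at the identity is the product
  of the two directions, and antisymmetrizing gives the commutator.\<close>

lemma lie_algebra_of_K0:
  fixes d :: "'b::real_normed_vector \<Rightarrow>\<^sub>L 'a::real_normed_vector"
  assumes fin: "finite_dim (UNIV :: 'a set)" "finite_dim (UNIV :: 'b set)"
  shows "lie_algebra (lie_algebra_of (K0 d))"
    and "lie_algebra_iso (lie_algebra_of (K0 d)) (k0 d) (tangent_coord (K0_set d))"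
proof -
  have inner: "dirderiv (\<lambda>y. x \<otimes>\<^bsub>K0 d\<^esub> y) \<one>\<^bsub>K0 d\<^esub> v = (fst x o\<^sub>L fst v, snd x o\<^sub>L snd v)" for x v
    unfolding K0_simps
    by (rule dirderiv_at[where D = "\<lambda>h. (fst x o\<^sub>L fst h, snd x o\<^sub>L snd h)"])
      (auto intro!: derivative_eq_intros)
  have outer: "dirderiv (\<lambda>x. (fst x o\<^sub>L fst w, snd x o\<^sub>L snd w)) \<one>\<^bsub>K0 d\<^esub> v
      = (fst v o\<^sub>L fst w, snd v o\<^sub>L snd w)" for v w
    by (rule dirderiv_at[where D = "\<lambda>h. (fst h o\<^sub>L fst w, snd h o\<^sub>L snd w)"])
      (auto intro!: derivative_eq_intros)
  note t = open_lie_group.lie_algebra_of_iso[OF open_lie_group_K0[OF fin] lie_algebra_k0]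
  show "lie_algebra (lie_algebra_of (K0 d))"
    by (rule t(1); simp add: k0_def inner outer case_prod_beta')
  show "lie_algebra_iso (lie_algebra_of (K0 d)) (k0 d) (tangent_coord (K0_set d))"
    by (rule t(2); simp add: k0_def inner outer case_prod_beta')
qed

lemma lie_group_hom_int_delta:
  fixes d :: "'b::real_normed_vector \<Rightarrow>\<^sub>L 'a::real_normed_vector"
  assumes fin: "finite_dim (UNIV :: 'a set)" "finite_dim (UNIV :: 'b set)"
  shows "lie_group_hom (K1 d) (K0 d) (int_delta d)"
proof -
  have U: "subspace (UNIV :: ('a \<Rightarrow>\<^sub>L 'b) set)" and S: "openin (top_of_set UNIV) (K1_set d)"
    using open_K1_set[OF fin] by simp_all
  have id: "smooth_on UNIV (K1_set d) (\<lambda>M. M)"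
    by (rule smooth_on_bounded_linear[OF U S bounded_linear_ident])
  have "smooth_on UNIV (K1_set d) (int_delta d)"
    unfolding int_delta_def
    by (intro smooth_on_Pair[OF U S] smooth_on_add[OF U S] smooth_on_const[OF U S]
        smooth_on_blinfun_compose[OF U S] id)
  then show ?thesis
    using int_delta_mem[of _ d] unfolding lie_group_hom_def hom_def K1_simps K0_simps
    by (auto simp: int_delta_mult intro!: smooth_map_open_submanifold[OF U S])
qed

lemma diff_hom_int_delta:
  fixes d :: "'b::real_normed_vector \<Rightarrow>\<^sub>L 'a::real_normed_vector"
  assumes fin: "finite_dim (UNIV :: 'a set)" "finite_dim (UNIV :: 'b set)"
  shows "diff_hom (K1 d) (K0 d) (int_delta d) (chart_vec (K1_set d) A) = chart_vec (K0_set d) (delta d A)"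
proof -
  have "dirderiv (int_delta d) \<one>\<^bsub>K1 d\<^esub> A = delta d A"
    unfolding int_delta_def
    by (rule dirderiv_at) (auto intro!: derivative_eq_intros simp: delta_def)
  moreover have "int_delta d \<one>\<^bsub>K1 d\<^esub> \<in> K0_set d"
    by (simp add: int_delta_mem K1_simps K1_set_iff GL_id)
  ultimately show ?thesis
    using diff_hom_open_lie_group[OF open_lie_group_K1[OF fin] open_lie_group_K0[OF fin]] by simp
qed

lemma lie_group_action_Phi:
  fixes d :: "'b::real_normed_vector \<Rightarrow>\<^sub>L 'a::real_normed_vector"
  assumes fin: "finite_dim (UNIV :: 'a set)" "finite_dim (UNIV :: 'b set)"
  shows "lie_group_action (K0 d) (K1 d) Phi"
proof -
  let ?E = "lcarrier (k0 d)" and ?S = "K0_set d" and ?T = "K1_set d"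
  have U: "subspace (UNIV :: ('a \<Rightarrow>\<^sub>L 'b) set)" and T: "openin (top_of_set UNIV) ?T"
    using open_K1_set[OF fin] by simp_all
  note E = subspace_Times[OF subspace_k0 U] openin_Times[OF openin_K0_set[OF fin] T]
  have proj: "smooth_on (?E \<times> UNIV) (?S \<times> ?T) (\<lambda>p. fst (fst p))"
      "smooth_on (?E \<times> UNIV) (?S \<times> ?T) (\<lambda>p. snd (fst p))"
      "smooth_on (?E \<times> UNIV) (?S \<times> ?T) snd"
    by (intro smooth_on_bounded_linear[OF E] bounded_linear_intros)+
  have "smooth_on (?E \<times> UNIV) (?S \<times> ?T) (\<lambda>(g, h). Phi g h)"
    unfolding case_prod_beta' Phi_eq
    by (rule smooth_on_blinfun_compose[OF E smooth_on_blinfun_compose[OF E proj(2,3)]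
          smooth_on_GL_inv[OF E proj(1)]]) (auto simp: K0_set_iff)
  then have "smooth_map (prod_manifold (mfd (K0 d)) (mfd (K1 d))) (mfd (K1 d)) (\<lambda>(g, h). Phi g h)"
    unfolding K0_simps K1_simps prod_manifold_open_submanifold
    by (intro smooth_map_open_submanifold[OF E]) (auto simp: Phi_mem)
  moreover have "Phi \<one>\<^bsub>K0 d\<^esub> h = h" for h
    by (simp add: K0_simps Phi_eq blinfun_compose_monoid)
  moreover have "Phi (g \<otimes>\<^bsub>K0 d\<^esub> g') h = Phi g (Phi g' h)" if "g \<in> ?S" "g' \<in> ?S" for g g' h
    using that by (simp add: K0_simps Phi_eq K0_set_iff GL_compose blinfun_compose_monoid)
  ultimately show ?thesis
    by (simp add: lie_group_action_def Phi_iso K0_simps(1))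
qed

text \<open>The product rule turns B1 A B0^-1 at the identity into X1 A - A X0, the sign coming from
  inversion. As \<open>GL_inv\<close> is differentiated within \<open>GL\<close>, the derivative is
  taken within \<open>K0_set d\<close> and evaluated in the direction \<open>X\<close> of its model
  space.\<close>

lemma diff_action_Phi:
  fixes d :: "'b::real_normed_vector \<Rightarrow>\<^sub>L 'a::real_normed_vector"
  assumes fin: "finite_dim (UNIV :: 'a set)" "finite_dim (UNIV :: 'b set)"
    and X: "X \<in> lcarrier (k0 d)"
  shows "diff_action (K0 d) (K1 d) Phi (chart_vec (K0_set d) X) (chart_vec (K1_set d) A)
    = chart_vec (K1_set d) (phi X A)"
proof -
  have inner: "dirderiv (Phi g) \<one>\<^bsub>K1 d\<^esub> A = snd g o\<^sub>L A o\<^sub>L GL_inv (fst g)" for g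
    unfolding Phi_eq[abs_def]
    by (rule dirderiv_at[where D = "\<lambda>h. snd g o\<^sub>L h o\<^sub>L GL_inv (fst g)"])
      (auto intro!: derivative_eq_intros)
  have one: "\<one>\<^bsub>K0 d\<^esub> \<in> K0_set d"
    by (simp add: K0_simps K0_set_iff GL_id)
  have sub: "fst ` K0_set d \<subseteq> GL"
    by (auto simp: K0_set_iff)
  have "(fst has_derivative fst) (at \<one>\<^bsub>K0 d\<^esub> within K0_set d)"
    by (intro bounded_linear_imp_has_derivative bounded_linear_fst)
  moreover have "(GL_inv has_derivative (\<lambda>H. - (GL_inv id_blinfun o\<^sub>L H o\<^sub>L GL_inv id_blinfun)))
      (at (fst \<one>\<^bsub>K0 d\<^esub>) within fst ` K0_set d)"
    using has_derivative_subset[OF has_derivative_GL_inv[OF GL_id] sub] by (simp add: K0_simps)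
  ultimately have "((\<lambda>g. GL_inv (fst g)) has_derivative
      (\<lambda>h. - (GL_inv id_blinfun o\<^sub>L fst h o\<^sub>L GL_inv id_blinfun))) (at \<one>\<^bsub>K0 d\<^esub> within K0_set d)"
    by (rule has_derivative_in_compose)
  then have "((\<lambda>g. snd g o\<^sub>L A o\<^sub>L GL_inv (fst g)) has_derivative
      (\<lambda>h. (id_blinfun o\<^sub>L A o\<^sub>L - fst h) + (snd h o\<^sub>L A o\<^sub>L id_blinfun)))
      (at \<one>\<^bsub>K0 d\<^esub> within K0_set d)"
    by (auto intro!: derivative_eq_intros simp: K0_simps blinfun_compose_monoid)
  from dirderiv_eqI[OF subspace_k0 openin_K0_set[OF fin(1,2)] one X this]
  have outer: "dirderiv (\<lambda>g. snd g o\<^sub>L A o\<^sub>L GL_inv (fst g)) \<one>\<^bsub>K0 d\<^esub> X = phi X A"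
    by (simp add: phi_def case_prod_beta' blinfun_alg)
  have "Phi g \<one>\<^bsub>K1 d\<^esub> \<in> K1_set d" for g
    by (simp add: Phi_eq K1_simps K1_set_iff GL_id)
  from diff_action_open_lie_group[where \<Phi> = Phi,
      OF open_lie_group_K0[OF fin(1,2)] open_lie_group_K1[OF fin(1,2)] this X UNIV_I]
  show ?thesis
    by (simp add: inner outer)
qed

section \<open>The crossed module of Lie groups Aut(V)\<close>

lemma crossed_module_Aut:
  fixes d :: "'b::real_normed_vector \<Rightarrow>\<^sub>L 'a::real_normed_vector"
  assumes fin: "finite_dim (UNIV :: 'a set)" "finite_dim (UNIV :: 'b set)"
  shows "crossed_module_lie_group (Aut_xmod d)"
proof -
  have "int_delta d (Phi g h) = g \<otimes>\<^bsub>K0 d\<^esub> int_delta d h \<otimes>\<^bsub>K0 d\<^esub> inv\<^bsub>K0 d\<^esub> g"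
    if "g \<in> K0_set d" for g h
    using that by (simp add: int_delta_Phi K0_inv K0_simps)
  moreover have "Phi (int_delta d h) h' = h \<otimes>\<^bsub>K1 d\<^esub> h' \<otimes>\<^bsub>K1 d\<^esub> inv\<^bsub>K1 d\<^esub> h"
    if h: "h \<in> K1_set d" "h' \<in> K1_set d" for h h'
  proof -
    interpret group "K1 d" by (rule group_K1)
    have g: "int_delta d h \<in> K0_set d"
      using h(1) by (rule int_delta_mem)
    let ?x = "Phi (int_delta d h) h'" and ?P = "id_blinfun + (d o\<^sub>L h)"
    have "?P \<in> GL"
      using h(1) by (simp add: K1_set_iff)
    then have "GL_inv ?P o\<^sub>L ?P = id_blinfun"
      by (rule GL_inv_props)
    \<comment> \<open>Composing with \<open>?P\<close> on the right cancels the inverse factor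
      contained in \<open>Phi\<close>.\<close>
    then have "?x o\<^sub>L ?P = ((h o\<^sub>L d) + id_blinfun) o\<^sub>L h'"
      by (simp add: Phi_eq int_delta_def blinfun_compose_monoid)
    moreover have "?x \<otimes>\<^bsub>K1 d\<^esub> h = (?x o\<^sub>L ?P) + h"
      by (simp add: K1_simps blinfun_alg)
    moreover have "(((h o\<^sub>L d) + id_blinfun) o\<^sub>L h') + h = h \<otimes>\<^bsub>K1 d\<^esub> h'"
      by (simp add: K1_simps blinfun_alg)
    \<comment> \<open>the Peiffer identity, multiplied by \<open>h\<close> from the right\<close>
    ultimately have "?x \<otimes>\<^bsub>K1 d\<^esub> h = h \<otimes>\<^bsub>K1 d\<^esub> h'"
      by simp
    then show ?thesis
      using h Phi_mem[OF g h(2)] by (metis K1_simps(1) inv_solve_right m_closed)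
  qed
  ultimately show ?thesis
    using open_lie_group.lie_group[OF open_lie_group_K1[OF fin, of d]]
      open_lie_group.lie_group[OF open_lie_group_K0[OF fin, of d]]
      lie_group_hom_int_delta[OF fin, of d] lie_group_action_Phi[OF fin, of d]
    by (simp add: crossed_module_lie_group_def Aut_xmod_def K0_simps(1) K1_simps(1))
qed

theorem proposition3p1:
  fixes d :: "'b::real_normed_vector \<Rightarrow>\<^sub>L 'a::real_normed_vector"
  assumes V0_fin: "finite_dim (UNIV :: 'a set)"
    and V1_fin: "finite_dim (UNIV :: 'b set)"
  shows
    "lie_group (K1 d)
     \<and> (\<forall>M\<in>carrier (K1 d).
          id_blinfun + (M o\<^sub>L d) \<in> GL \<and> id_blinfun + (d o\<^sub>L M) \<in> GL \<and>
          inv\<^bsub>K1 d\<^esub> M = - (GL_inv (id_blinfun + (M o\<^sub>L d)) o\<^sub>L M) \<and>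
          inv\<^bsub>K1 d\<^esub> M = - (M o\<^sub>L GL_inv (id_blinfun + (d o\<^sub>L M))))
     \<and> lie_algebra_iso (lie_algebra_of (K1 d)) (k1 d) (tangent_coord (carrier (K1 d)))

     \<and> lie_group (K0 d)
     \<and> lie_algebra_iso (lie_algebra_of (K0 d)) (k0 d) (tangent_coord (carrier (K0 d)))

     \<and> lie_group_hom (K1 d) (K0 d) (int_delta d)
     \<and> lie_algebra_hom (k1 d) (k0 d) (delta d)
     \<and> (\<forall>A\<in>lcarrier (lie_algebra_of (K1 d)).
          tangent_coord (carrier (K0 d)) (diff_hom (K1 d) (K0 d) (int_delta d) A)
          = delta d (tangent_coord (carrier (K1 d)) A))

     \<and> lie_group_action (K0 d) (K1 d) Phi
     \<and> lie_algebra_action (k0 d) (k1 d) phi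
     \<and> (\<forall>X\<in>lcarrier (lie_algebra_of (K0 d)). \<forall>A\<in>lcarrier (lie_algebra_of (K1 d)).
          tangent_coord (carrier (K1 d)) (diff_action (K0 d) (K1 d) Phi X A)
          = phi (tangent_coord (carrier (K0 d)) X) (tangent_coord (carrier (K1 d)) A))

     \<and> crossed_module_lie_group (Aut_xmod d)
     \<and> crossed_module_lie_algebra (differentiate (Aut_xmod d))
     \<and> crossed_module_lie_algebra (End_xmod d)
     \<and> crossed_module_lie_algebra_iso (differentiate (Aut_xmod d)) (End_xmod d)
          (tangent_coord (carrier (K1 d))) (tangent_coord (carrier (K0 d)))"
proof -
  note fin = V0_fin V1_fin
  interpret K1: open_lie_group "K1 d" UNIV "K1_set d"
    by (rule open_lie_group_K1[OF fin])
  interpret K0: open_lie_group "K0 d" "lcarrier (k0 d)" "K0_set d"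
    by (rule open_lie_group_K0[OF fin])
  \<comment> \<open>Stated through \<open>chart_vec\<close>, so that it yields not only the
    coordinates but also membership in the tangent space, which the transport of the crossed module
    asks for.\<close>
  have dhom: "diff_hom (K1 d) (K0 d) (int_delta d) A = chart_vec (K0_set d) (delta d (tangent_coord (K1_set d) A))"
    if "A \<in> lcarrier (lie_algebra_of (K1 d))" for A
    using that by (auto simp: K1.lie_algebra_of_simps diff_hom_int_delta[OF fin])
  have dact: "diff_action (K0 d) (K1 d) Phi X A = chart_vec (K1_set d)
      (phi (tangent_coord (K0_set d) X) (tangent_coord (K1_set d) A))"
    if "X \<in> lcarrier (lie_algebra_of (K0 d))" "A \<in> lcarrier (lie_algebra_of (K1 d))" for X A
    using that by (auto simp: K1.lie_algebra_of_simps K0.lie_algebra_of_simps diff_action_Phi[OF fin])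
  note End = crossed_module_End[of d]
  have hom: "lie_algebra_hom (k1 d) (k0 d) (delta d)" and act: "lie_algebra_action (k0 d) (k1 d) phi"
    using End by (simp_all add: crossed_module_lie_algebra_def End_xmod_def)
  \<comment> \<open>The isomorphism precedes the crossed module axioms of the differentiated side,
    because those are pulled back along it.\<close>
  have xiso: "crossed_module_lie_algebra_iso (differentiate (Aut_xmod d)) (End_xmod d)
      (tangent_coord (K1_set d)) (tangent_coord (K0_set d))"
    using lie_algebra_of_K1(2)[OF fin, of d] lie_algebra_of_K0(2)[OF fin, of d]
    by (simp add: crossed_module_lie_algebra_iso_def differentiate_def Aut_xmod_def End_xmod_def dhom dact)
  have delta: "delta d A \<in> lcarrier (k0 d)" for A
    by (simp add: mem_k0_iff delta_def)
  have "crossed_module_lie_algebra (differentiate (Aut_xmod d))"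
    unfolding differentiate_def Aut_xmod_def End_xmod_def prod.case
  proof (rule crossed_module_lie_algebra_transport)
    show "crossed_module_lie_algebra (k1 d, k0 d, delta d, phi)"
      using End by (simp add: End_xmod_def)
    show "crossed_module_lie_algebra_iso
        (lie_algebra_of (K1 d), lie_algebra_of (K0 d), diff_hom (K1 d) (K0 d) (int_delta d), diff_action (K0 d) (K1 d) Phi)
        (k1 d, k0 d, delta d, phi) (tangent_coord (K1_set d)) (tangent_coord (K0_set d))"
      using xiso by (simp add: differentiate_def Aut_xmod_def End_xmod_def)
  qed (simp_all add: lie_algebra_of_K1(1)[OF fin] lie_algebra_of_K0(1)[OF fin] dhom dact
      K1.lie_algebra_of_simps K0.lie_algebra_of_simps delta)
  moreover have "id_blinfun + (M o\<^sub>L d) \<in> GL \<and> id_blinfun + (d o\<^sub>L M) \<in> GL \<and>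
      inv\<^bsub>K1 d\<^esub> M = - (GL_inv (id_blinfun + (M o\<^sub>L d)) o\<^sub>L M) \<and>
      inv\<^bsub>K1 d\<^esub> M = - (M o\<^sub>L GL_inv (id_blinfun + (d o\<^sub>L M)))" if "M \<in> K1_set d" for M
    using that K1_inverse(1)[OF that] K1_inv[OF that] by (simp add: K1_set_iff add.commute)
  moreover note K1.lie_group K0.lie_group lie_algebra_of_K1(2)[OF fin, of d]
    lie_algebra_of_K0(2)[OF fin, of d] lie_group_hom_int_delta[OF fin, of d] hom act
    lie_group_action_Phi[OF fin, of d] crossed_module_Aut[OF fin, of d] End xiso
  ultimately show ?thesis
    unfolding K1_simps(1) K0_simps(1) by (intro conjI ballI; simp add: dhom dact)
qed

end
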